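(* For every linear ordering $(L,<)$ with $|L|=\kappa\ge\lambda$ there is a model $\mathcal{G}^*$ of $\phi_{\mathcal{F}}$ of cardinality $\kappa$ and a one-to-one function $F:L\to\mathcal{G}^*$ such that $x<y$ iff $F(x)\triangleleft F(y)$ for all $x,y\in L$, and $F(x)$ is $0$-colored for all $x\in L$.
   Context: Let $\lambda$ be an uncountable cardinal and $\mathcal{M}$ a countable structure in a countable language $\mathcal{L}_0$ containing $<$, where $<$ is a dense linear ordering on $\mathcal{M}$, whose Scott sentence $\phi$ characterizes $\lambda$ (has a model of cardinality $\lambda$ and none of cardinality $\lambda^+$). Let $\mathcal{L}$ extend $\mathcal{L}_0$ by unary predicates $V,M,N$, a binary relation $\triangleleft$ and a binary function symbol $f$. $K(\mathcal{M})$ is the class of countable $\mathcal{L}$-structures $\mathcal{A}$ such that: (1) $V(\mathcal{A}),M(\mathcal{A})$ partition the universe, $V(\mathcal{A})$ is finite and $M(\mathcal{A})$ (with its $\mathcal{L}_0$-structure) is $\mathcal{M}$; (2) $\triangleleft$ is a linear order on $V(\mathcal{A})$; (3) for $x\ne y$ in $V(\mathcal{A})$, $f(x,y)=f(y,x)\in M(\mathcal{A})$; (4) if $x\triangleleft y\triangleleft z$ are distinct elements of $V(\mathcal{A})$, then either $f(x,y)=f(x,z)=f(y,z)$, or $f(x,y)=f(x,z)<f(y,z)$, or $f(x,z)=f(y,z)<f(x,y)$; (5) $N(x)$ implies $x\in V(\mathcal{A})$. An element $x\in V$ is $1$-colored if $N(x)$ and $0$-colored otherwise. A finitely generated$/\mathcal{M}$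 substructure of a structure containing $\mathcal{M}$ is one of the form $\langle A_0\rangle\cup\mathcal{M}$, $A_0$ finite. $\mathcal{F}$ is the Fraïssé limit of $K(\mathcal{M})$: the (unique up to isomorphism) countable $\mathcal{L}$-structure containing $\mathcal{M}$ whose finitely generated$/\mathcal{M}$ substructures are, up to isomorphism, exactly the members of $K(\mathcal{M})$ and in which every isomorphism between finitely generated$/\mathcal{M}$ substructures extends to an automorphism; $\phi_{\mathcal{F}}$ is its Scott sentence. *)

theory Defs
  imports Main "HOL-Library.Countable_Set"
begin

unbundle cardinal_syntax

section \<open>Languages and structures\<close>

record ('f, 'r) lang =
  funs :: "'f set"
  rels :: "'r set"
  farity :: "'f \<Rightarrow> nat"
  rarity :: "'r \<Rightarrow> nat"

definition countable_lang :: "('f, 'r) lang \<Rightarrow> bool" where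
  "countable_lang L \<longleftrightarrow> countable (funs L) \<and> countable (rels L)"

text \<open>Interpretations only matter for symbols of the language applied to tuples over the
  universe of the right length; all notions below ignore the remaining values.\<close>

record ('f, 'r, 'a) struct =
  univ :: "'a set"
  fint :: "'f \<Rightarrow> 'a list \<Rightarrow> 'a"
  rint :: "'r \<Rightarrow> 'a list \<Rightarrow> bool"

definition closed_in :: "('f, 'r) lang \<Rightarrow> ('f, 'r, 'a) struct \<Rightarrow> 'a set \<Rightarrow> bool" where
  "closed_in L A B \<longleftrightarrow>
     (\<forall>g\<in>funs L. \<forall>xs. set xs \<subseteq> B \<and> length xs = farity L g \<longrightarrow> fint A g xs \<in> B)"

definition is_struct :: "('f, 'r) lang \<Rightarrow> ('f, 'r, 'a) struct \<Rightarrow> bool" where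
  "is_struct L A \<longleftrightarrow> univ A \<noteq> {} \<and> closed_in L A (univ A)"

definition iso :: "('f, 'r) lang \<Rightarrow> ('f, 'r, 'a) struct \<Rightarrow> ('f, 'r, 'b) struct \<Rightarrow> ('a \<Rightarrow> 'b) \<Rightarrow> bool" where
  "iso L A B h \<longleftrightarrow>
     is_struct L A \<and> is_struct L B \<and> bij_betw h (univ A) (univ B) \<and>
     (\<forall>g\<in>funs L. \<forall>xs. set xs \<subseteq> univ A \<and> length xs = farity L g \<longrightarrow>
        h (fint A g xs) = fint B g (map h xs)) \<and>
     (\<forall>R\<in>rels L. \<forall>xs. set xs \<subseteq> univ A \<and> length xs = rarity L R \<longrightarrow>
        (rint A R xs \<longleftrightarrow> rint B R (map h xs)))"

definition isomorphic :: "('f, 'r) lang \<Rightarrow> ('f, 'r, 'a) struct \<Rightarrow> ('f, 'r, 'b) struct \<Rightarrow> bool" where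
  "isomorphic L A B \<longleftrightarrow> (\<exists>h. iso L A B h)"

definition restrict_struct :: "('f, 'r, 'a) struct \<Rightarrow> 'a set \<Rightarrow> ('f, 'r, 'a) struct" where
  "restrict_struct A B = \<lparr>univ = B, fint = fint A, rint = rint A\<rparr>"

definition generated :: "('f, 'r) lang \<Rightarrow> ('f, 'r, 'a) struct \<Rightarrow> 'a set \<Rightarrow> 'a set" where
  "generated L A A0 = \<Inter>{B. A0 \<subseteq> B \<and> B \<subseteq> univ A \<and> closed_in L A B}"

section \<open>The infinitary logic $L_{\omega_1,\omega}$\<close>

datatype 'f tm = Var nat | Fn 'f "'f tm list"

datatype ('f, 'r) fm =
    Eq "'f tm" "'f tm"
  | Rel 'r "'f tm list"
  | Neg "('f, 'r) fm"
  | Conj "nat \<Rightarrow> ('f, 'r) fm"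
  | Ex nat "('f, 'r) fm"

fun tm_vars :: "'f tm \<Rightarrow> nat set" where
  "tm_vars (Var n) = {n}"
| "tm_vars (Fn g ts) = (\<Union>t\<in>set ts. tm_vars t)"

fun wf_tm :: "('f, 'r) lang \<Rightarrow> 'f tm \<Rightarrow> bool" where
  "wf_tm L (Var n) \<longleftrightarrow> True"
| "wf_tm L (Fn g ts) \<longleftrightarrow> g \<in> funs L \<and> length ts = farity L g \<and> (\<forall>t\<in>set ts. wf_tm L t)"

fun tm_val :: "('f, 'r, 'a) struct \<Rightarrow> (nat \<Rightarrow> 'a) \<Rightarrow> 'f tm \<Rightarrow> 'a" where
  "tm_val A e (Var n) = e n"
| "tm_val A e (Fn g ts) = fint A g (map (tm_val A e) ts)"

primrec free_vars :: "('f, 'r) fm \<Rightarrow> nat set" where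
  "free_vars (Eq s t) = tm_vars s \<union> tm_vars t"
| "free_vars (Rel R ts) = (\<Union>t\<in>set ts. tm_vars t)"
| "free_vars (Neg p) = free_vars p"
| "free_vars (Conj ps) = (\<Union>i. free_vars (ps i))"
| "free_vars (Ex n p) = free_vars p - {n}"

primrec wf_fm :: "('f, 'r) lang \<Rightarrow> ('f, 'r) fm \<Rightarrow> bool" where
  "wf_fm L (Eq s t) \<longleftrightarrow> wf_tm L s \<and> wf_tm L t"
| "wf_fm L (Rel R ts) \<longleftrightarrow> R \<in> rels L \<and> length ts = rarity L R \<and> (\<forall>t\<in>set ts. wf_tm L t)"
| "wf_fm L (Neg p) \<longleftrightarrow> wf_fm L p"
| "wf_fm L (Conj ps) \<longleftrightarrow> (\<forall>i. wf_fm L (ps i))"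
| "wf_fm L (Ex n p) \<longleftrightarrow> wf_fm L p"

primrec sat :: "('f, 'r, 'a) struct \<Rightarrow> ('f, 'r) fm \<Rightarrow> (nat \<Rightarrow> 'a) \<Rightarrow> bool" where
  "sat A (Eq s t) = (\<lambda>e. tm_val A e s = tm_val A e t)"
| "sat A (Rel R ts) = (\<lambda>e. rint A R (map (tm_val A e) ts))"
| "sat A (Neg p) = (\<lambda>e. \<not> sat A p e)"
| "sat A (Conj ps) = (\<lambda>e. \<forall>i. sat A (ps i) e)"
| "sat A (Ex n p) = (\<lambda>e. \<exists>a\<in>univ A. sat A p (e(n := a)))"

text \<open>Each quantifier binds one variable and a subformula lies under finitely many quantifiers,
  so all subformulas of a sentence have only finitely many free variables, as is required in
  $L_{\omega_1,\omega}$.\<close>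

definition sentence :: "('f, 'r) lang \<Rightarrow> ('f, 'r) fm \<Rightarrow> bool" where
  "sentence L p \<longleftrightarrow> wf_fm L p \<and> free_vars p = {}"

definition is_model :: "('f, 'r) lang \<Rightarrow> ('f, 'r, 'a) struct \<Rightarrow> ('f, 'r) fm \<Rightarrow> bool" where
  "is_model L A p \<longleftrightarrow> is_struct L A \<and> (\<forall>e. range e \<subseteq> univ A \<longrightarrow> sat A p e)"

text \<open>A Scott sentence of \<open>A\<close> is a sentence whose countable models are exactly the countable
  structures isomorphic to \<open>A\<close>; every countable structure has a copy with universe
  a subset of \<open>nat\<close>.\<close>

definition scott_sentence :: "('f, 'r) lang \<Rightarrow> ('f, 'r, 'a) struct \<Rightarrow> ('f, 'r) fm \<Rightarrow> bool" where
  "scott_sentence L A p \<longleftrightarrow>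
     sentence L p \<and>
     (\<forall>B :: ('f, 'r, nat) struct. is_struct L B \<longrightarrow> (is_model L B p \<longleftrightarrow> isomorphic L B A))"

text \<open>For a cardinal \<open>\<lambda>\<close> on the type \<open>'k\<close>, every structure of cardinality \<open>\<lambda>\<close> (respectively
  \<open>\<lambda>\<^sup>+\<close>) has a copy on the type \<open>'k\<close> (respectively \<open>'k set\<close>, the type carrying \<open>cardSuc \<lambda>\<close>).\<close>

definition characterizes :: "('f, 'r) lang \<Rightarrow> ('f, 'r) fm \<Rightarrow> 'k rel \<Rightarrow> bool" where
  "characterizes L p lam \<longleftrightarrow>
     (\<exists>A :: ('f, 'r, 'k) struct. is_model L A p \<and> |univ A| =o lam) \<and>
     \<not> (\<exists>A :: ('f, 'r, 'k set) struct. is_model L A p \<and> |univ A| =o cardSuc lam)"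

definition dense_linear_order_struct :: "('f, 'r, 'a) struct \<Rightarrow> 'r \<Rightarrow> bool" where
  "dense_linear_order_struct A lt \<longleftrightarrow>
     strict_linear_order_on (univ A) {(x, y) \<in> univ A \<times> univ A. rint A lt [x, y]} \<and>
     (\<forall>x\<in>univ A. \<forall>y\<in>univ A. rint A lt [x, y] \<longrightarrow>
        (\<exists>z\<in>univ A. rint A lt [x, z] \<and> rint A lt [z, y]))"

section \<open>The class $K(\mathcal M)$ and its limit\<close>

datatype 'f xfun = OldF 'f | SymF
datatype 'r xrel = OldR 'r | SymV | SymM | SymN | SymTri

definition ext_lang :: "('f, 'r) lang \<Rightarrow> ('f xfun, 'r xrel) lang" where
  "ext_lang L0 =
     \<lparr>funs = insert SymF (OldF ` funs L0),
      rels = OldR ` rels L0 \<union> {SymV, SymM, SymN, SymTri},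
      farity = (\<lambda>g. case g of OldF g0 \<Rightarrow> farity L0 g0 | SymF \<Rightarrow> 2),
      rarity = (\<lambda>R. case R of OldR R0 \<Rightarrow> rarity L0 R0 | SymV \<Rightarrow> 1 | SymM \<Rightarrow> 1 | SymN \<Rightarrow> 1
                   | SymTri \<Rightarrow> 2)\<rparr>"

type_synonym ('f, 'r, 'a) xstruct = "('f xfun, 'r xrel, 'a) struct"

definition Vpart :: "('f, 'r, 'a) xstruct \<Rightarrow> 'a set" where
  "Vpart A = {x \<in> univ A. rint A SymV [x]}"

definition Mpart :: "('f, 'r, 'a) xstruct \<Rightarrow> 'a set" where
  "Mpart A = {x \<in> univ A. rint A SymM [x]}"

definition Mstruct :: "('f, 'r, 'a) xstruct \<Rightarrow> ('f, 'r, 'a) struct" where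
  "Mstruct A = \<lparr>univ = Mpart A, fint = (\<lambda>g. fint A (OldF g)), rint = (\<lambda>R. rint A (OldR R))\<rparr>"

abbreviation tri :: "('f, 'r, 'a) xstruct \<Rightarrow> 'a \<Rightarrow> 'a \<Rightarrow> bool" where
  "tri A x y \<equiv> rint A SymTri [x, y]"

abbreviation fval :: "('f, 'r, 'a) xstruct \<Rightarrow> 'a \<Rightarrow> 'a \<Rightarrow> 'a" where
  "fval A x y \<equiv> fint A SymF [x, y]"

definition one_colored :: "('f, 'r, 'a) xstruct \<Rightarrow> 'a \<Rightarrow> bool" where
  "one_colored A x \<longleftrightarrow> x \<in> Vpart A \<and> rint A SymN [x]"

definition zero_colored :: "('f, 'r, 'a) xstruct \<Rightarrow> 'a \<Rightarrow> bool" where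
  "zero_colored A x \<longleftrightarrow> x \<in> Vpart A \<and> \<not> rint A SymN [x]"

text \<open>The symbols of \<open>L0\<close> live on the \<open>M\<close>-part, \<open>\<triangleleft>\<close> lives on the \<open>V\<close>-part, and \<open>f\<close> on pairs
  of distinct elements of the \<open>V\<close>-part. Since function symbols are interpreted by total functions
  here, a function applied outside its intended domain returns its first argument; relations are
  false outside theirs. Without such a convention the values there would be arbitrary, already on
  \<open>M\<close>, and the class would have no joint embedding property.\<close>

definition off_domain_trivial :: "('f, 'r) lang \<Rightarrow> ('f, 'r, 'a) xstruct \<Rightarrow> bool" where
  "off_domain_trivial L0 A \<longleftrightarrow>
     (\<forall>R\<in>rels L0. \<forall>xs. set xs \<subseteq> univ A \<and> length xs = rarity L0 R \<and> rint A (OldR R) xs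
        \<longrightarrow> set xs \<subseteq> Mpart A) \<and>
     (\<forall>g\<in>funs L0. \<forall>xs. set xs \<subseteq> univ A \<and> length xs = farity L0 g \<and> \<not> set xs \<subseteq> Mpart A
        \<longrightarrow> fint A (OldF g) xs = hd xs) \<and>
     (\<forall>x\<in>univ A. \<forall>y\<in>univ A. tri A x y \<longrightarrow> x \<in> Vpart A \<and> y \<in> Vpart A) \<and>
     (\<forall>x\<in>univ A. \<forall>y\<in>univ A. \<not> (x \<in> Vpart A \<and> y \<in> Vpart A \<and> x \<noteq> y) \<longrightarrow> fval A x y = x)"

text \<open>Membership in $K(\mathcal M)$. As the class only matters up to isomorphism, it is closed under
  isomorphism here: the \<open>M\<close>-part is required to be a copy of \<open>\<M>\<close>.\<close>

definition in_K :: "('f, 'r) lang \<Rightarrow> 'r \<Rightarrow> ('f, 'r, 'm) struct \<Rightarrow> ('f, 'r, 'a) xstruct \<Rightarrow> bool" where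
  "in_K L0 lt M A \<longleftrightarrow>
     is_struct (ext_lang L0) A \<and> countable (univ A) \<and> off_domain_trivial L0 A \<and>
     Vpart A \<union> Mpart A = univ A \<and> Vpart A \<inter> Mpart A = {} \<and>
     finite (Vpart A) \<and> isomorphic L0 (Mstruct A) M \<and>
     strict_linear_order_on (Vpart A) {(x, y) \<in> Vpart A \<times> Vpart A. tri A x y} \<and>
     (\<forall>x\<in>Vpart A. \<forall>y\<in>Vpart A. x \<noteq> y \<longrightarrow> fval A x y = fval A y x \<and> fval A x y \<in> Mpart A) \<and>
     (\<forall>x\<in>Vpart A. \<forall>y\<in>Vpart A. \<forall>z\<in>Vpart A.
        x \<noteq> y \<and> y \<noteq> z \<and> x \<noteq> z \<and> tri A x y \<and> tri A y z \<longrightarrow>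
          (fval A x y = fval A x z \<and> fval A x z = fval A y z) \<or>
          (fval A x y = fval A x z \<and> rint A (OldR lt) [fval A x z, fval A y z]) \<or>
          (fval A x z = fval A y z \<and> rint A (OldR lt) [fval A y z, fval A x y])) \<and>
     (\<forall>x\<in>univ A. rint A SymN [x] \<longrightarrow> x \<in> Vpart A)"

text \<open>The substructure $\langle A_0\rangle\cup\mathcal M$ of a structure whose \<open>M\<close>-part is \<open>\<M>\<close>.\<close>

definition fg_over_M ::
  "('f, 'r) lang \<Rightarrow> ('f, 'r, 'a) xstruct \<Rightarrow> 'a set \<Rightarrow> ('f, 'r, 'a) xstruct" where
  "fg_over_M L0 A A0 = restrict_struct A (generated (ext_lang L0) A A0 \<union> Mpart A)"

text \<open>All members of $K(\mathcal M)$ are countable, so it suffices to let them range over structures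
  on \<open>nat\<close>.\<close>

definition fraisse_limit ::
  "('f, 'r) lang \<Rightarrow> 'r \<Rightarrow> ('f, 'r, 'm) struct \<Rightarrow> ('f, 'r, 'a) xstruct \<Rightarrow> bool" where
  "fraisse_limit L0 lt M F \<longleftrightarrow>
     is_struct (ext_lang L0) F \<and> countable (univ F) \<and> isomorphic L0 (Mstruct F) M \<and>
     (\<forall>A0. finite A0 \<and> A0 \<subseteq> univ F \<longrightarrow> in_K L0 lt M (fg_over_M L0 F A0)) \<and>
     (\<forall>A :: ('f, 'r, nat) xstruct. in_K L0 lt M A \<longrightarrow>
        (\<exists>A0. finite A0 \<and> A0 \<subseteq> univ F \<and> isomorphic (ext_lang L0) A (fg_over_M L0 F A0))) \<and>
     (\<forall>A0 B0 h. finite A0 \<and> A0 \<subseteq> univ F \<and> finite B0 \<and> B0 \<subseteq> univ F \<and>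
        iso (ext_lang L0) (fg_over_M L0 F A0) (fg_over_M L0 F B0) h \<longrightarrow>
        (\<exists>g. iso (ext_lang L0) F F g \<and> (\<forall>x\<in>univ (fg_over_M L0 F A0). g x = h x)))"

end

theory Submission
  imports Defs Complex_Main
begin

text \<open>The model can keep the countable \<open>M\<close>-part: condition (4) allows arbitrarily many points at one
  common distance \<open>m\<close>, so the elements of \<open>V\<close> can be taken to be the finitely supported functions
  from \<open>M\<close> to a dense order without endpoints \<open>Q\<close> containing \<open>L\<close>, where \<open>f s t\<close> is the least
  argument at which \<open>s\<close> and \<open>t\<close> differ and \<open>\<triangleleft>\<close> is the order of the values there. If \<open>Q\<close> is
  divided into two dense colour classes and \<open>N s\<close> records the parity of the number of coloured values
  of \<open>s\<close>, every one-point extension of a finite subset is realized. Partial isomorphisms with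
  finite \<open>V\<close>-part that contain the whole \<open>M\<close>-part then form a back-and-forth system with the limit,
  whose own extension property comes from homogeneity. Hence the two structures satisfy the same
  infinitary sentences, also when \<open>L\<close> is uncountable. The order \<open>L\<close> sits in \<open>V\<close> as a set of
  functions supported at a single point.\<close>

section \<open>Isomorphisms and back-and-forth systems\<close>

text \<open>A Scott sentence is pinned down only by its countable models, so an uncountable
  candidate must be compared with the limit directly. The two directions of this comparison are
  unequal: the back step works for every structure that satisfies the conditions of the class over a
  copy of \<open>M\<close>, because the limit is universal and homogeneous. Only the forth step
  depends on the construction.

  Finite support answers two difficulties at once. The order of \<open>M\<close> is dense, so
  arbitrary functions on it need not have a first difference; and there may be more than |L| of
  them.

  The colour of a function cannot be its value at a fixed argument: a new point may be forced to
  follow an old one there and still need the other colour. Below its branching level a new point has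
  no freedom, but with parity the single value at that level, wherever it lies, can produce either
  colour. The embedded copy of \<open>L\<close> uses only uncoloured values, hence has even
  parity.\<close>

lemma restrict_struct_simps [simp]:
  "univ (restrict_struct A X) = X" "fint (restrict_struct A X) = fint A"
  "rint (restrict_struct A X) = rint A"
  by (simp_all add: restrict_struct_def)

lemma closed_in_restrict [simp]: "closed_in L (restrict_struct A X) Y \<longleftrightarrow> closed_in L A Y"
  by (simp add: closed_in_def)

lemma isoD:
  assumes "iso L A B h"
  shows "is_struct L A" "is_struct L B" "bij_betw h (univ A) (univ B)"
    "inj_on h (univ A)" "h ` univ A = univ B"
    "\<And>g xs. g \<in> funs L \<Longrightarrow> set xs \<subseteq> univ A \<Longrightarrow> length xs = farity L g \<Longrightarrow>
        h (fint A g xs) = fint B g (map h xs)"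
    "\<And>R xs. R \<in> rels L \<Longrightarrow> set xs \<subseteq> univ A \<Longrightarrow> length xs = rarity L R \<Longrightarrow>
        rint A R xs \<longleftrightarrow> rint B R (map h xs)"
  using assms unfolding iso_def bij_betw_def by blast+

lemma fint_in_univ:
  assumes "is_struct L A" "g \<in> funs L" "set xs \<subseteq> univ A" "length xs = farity L g"
  shows "fint A g xs \<in> univ A"
  using assms by (auto simp: is_struct_def closed_in_def)

lemma iso_comp:
  assumes "iso L A B h" "iso L B C k"
  shows "iso L A C (k \<circ> h)"
proof -
  note h = isoD[OF assms(1)] and k = isoD[OF assms(2)]
  have sub: "set (map h xs) \<subseteq> univ B" if "set xs \<subseteq> univ A" for xs
    using that h(5) by auto
  have "bij_betw (k \<circ> h) (univ A) (univ C)"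
    using h(3) k(3) by (rule bij_betw_trans)
  moreover have "(k \<circ> h) (fint A g xs) = fint C g (map (k \<circ> h) xs)"
    if "g \<in> funs L" "set xs \<subseteq> univ A" "length xs = farity L g" for g xs
    using h(6)[OF that] k(6)[OF that(1) sub[OF that(2)]] that(3) by simp
  moreover have "rint A R xs \<longleftrightarrow> rint C R (map (k \<circ> h) xs)"
    if "R \<in> rels L" "set xs \<subseteq> univ A" "length xs = rarity L R" for R xs
    using h(7)[OF that] k(7)[OF that(1) sub[OF that(2)]] that(3) by simp
  ultimately show ?thesis
    using h(1) k(2) by (auto simp: iso_def)
qed

lemma iso_cong:
  assumes "iso L A B h" "\<And>x. x \<in> univ A \<Longrightarrow> k x = h x"
  shows "iso L A B k"
proof -
  note h = isoD[OF assms(1)]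
  have map_eq: "map k xs = map h xs" if "set xs \<subseteq> univ A" for xs
    using that assms(2) by auto
  have "bij_betw k (univ A) (univ B)"
    using h(3) assms(2) by (simp cong: bij_betw_cong)
  moreover have "k (fint A g xs) = fint B g (map k xs)"
    if "g \<in> funs L" "set xs \<subseteq> univ A" "length xs = farity L g" for g xs
    unfolding map_eq[OF that(2)] using h(6)[OF that] fint_in_univ[OF h(1) that] assms(2) by simp
  moreover have "rint A R xs \<longleftrightarrow> rint B R (map k xs)"
    if "R \<in> rels L" "set xs \<subseteq> univ A" "length xs = rarity L R" for R xs
    unfolding map_eq[OF that(2)] by (rule h(7)[OF that])
  ultimately show ?thesis
    using h(1,2) unfolding iso_def by blast
qed

lemma iso_inv:
  assumes "iso L A B h"
  shows "iso L B A (inv_into (univ A) h)"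
proof -
  note h = isoD[OF assms]
  let ?k = "inv_into (univ A) h"
  have map_hk: "map h (map ?k xs) = xs" if "set xs \<subseteq> univ B" for xs
    using that h(5) by (auto simp: f_inv_into_f intro!: map_idI)
  have sub: "set (map ?k xs) \<subseteq> univ A" if "set xs \<subseteq> univ B" for xs
    using that h(5) by (auto intro!: inv_into_into)
  have "?k (fint B g xs) = fint A g (map ?k xs)"
    if "g \<in> funs L" "set xs \<subseteq> univ B" "length xs = farity L g" for g xs
  proof -
    have "h (fint A g (map ?k xs)) = fint B g xs"
      using h(6)[OF that(1) sub[OF that(2)]] that(3) map_hk[OF that(2)] by simp
    moreover have "fint A g (map ?k xs) \<in> univ A"
      using that(3) by (intro fint_in_univ[OF h(1) that(1) sub[OF that(2)]]) simp
    ultimately show ?thesis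
      using h(4) by (metis inv_into_f_f)
  qed
  moreover have "rint B R xs \<longleftrightarrow> rint A R (map ?k xs)"
    if "R \<in> rels L" "set xs \<subseteq> univ B" "length xs = rarity L R" for R xs
    using h(7)[OF that(1) sub[OF that(2)]] that(3) map_hk[OF that(2)] by simp
  ultimately show ?thesis
    unfolding iso_def using h(1,2) bij_betw_inv_into[OF h(3)] by blast
qed

text \<open>Symbols are interpreted by pulling tuples back along the inverse of \<open>h\<close>.
  This moves countable structures to \<open>nat\<close>, where Scott sentences and the universality
  of the limit are stated, and finally moves the model to the type of \<open>L\<close>.\<close>

lemma iso_transport:
  assumes "is_struct L A" "inj_on h (univ A)"
  obtains B where "iso L A B h" "univ B = h ` univ A"
proof
  let ?k = "inv_into (univ A) h"
  let ?B = "\<lparr>univ = h ` univ A, fint = (\<lambda>g xs. h (fint A g (map ?k xs))),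
    rint = (\<lambda>R xs. rint A R (map ?k xs))\<rparr>"
  have map_kh: "map ?k (map h xs) = xs" if "set xs \<subseteq> univ A" for xs
    using that assms(2) by (auto intro!: map_idI)
  have sub: "set (map ?k xs) \<subseteq> univ A" if "set xs \<subseteq> h ` univ A" for xs
    using that by (auto intro!: inv_into_into)
  have "h (fint A g (map ?k xs)) \<in> h ` univ A"
    if "g \<in> funs L" "set xs \<subseteq> h ` univ A" "length xs = farity L g" for g xs
    using that(3) by (intro imageI fint_in_univ[OF assms(1) that(1) sub[OF that(2)]]) simp
  then have "is_struct L ?B"
    using assms(1) by (auto simp: is_struct_def closed_in_def)
  then show "iso L A ?B h"
    unfolding iso_def using assms map_kh by (simp add: bij_betw_def del: map_map)
qed simp

section \<open>Preservation of infinitary formulas (Karp's criterion)\<close>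

lemma tm_val_iso:
  assumes "iso L (restrict_struct A X) (restrict_struct B Y) h"
  shows "wf_tm L t \<Longrightarrow> \<forall>n\<in>tm_vars t. e n \<in> X \<and> e' n = h (e n) \<Longrightarrow>
    tm_val A e t \<in> X \<and> tm_val B e' t = h (tm_val A e t)"
proof (induction t)
  case (Fn g ts)
  note h = isoD[OF assms, simplified]
  have ts: "tm_val A e t \<in> X \<and> tm_val B e' t = h (tm_val A e t)" if "t \<in> set ts" for t
    using Fn that by auto
  let ?vs = "map (tm_val A e) ts"
  have sub: "set ?vs \<subseteq> X" using ts by auto
  have eq: "map (tm_val B e') ts = map h ?vs" using ts by auto
  have g: "g \<in> funs L" "length ?vs = farity L g" using Fn.prems(1) by auto
  have "fint A g ?vs \<in> X"
    using fint_in_univ[OF h(1), simplified, OF g(1) sub] g(2) by simp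
  then show ?case
    using h(6)[OF g(1) sub g(2)] eq by (simp del: map_map)
qed simp

text \<open>Infinite conjunctions cost nothing, since one and the same map serves all conjuncts;
  only a quantifier requires a move in the system. The domains \<open>X\<close> may be infinite,
  which later allows them to contain the whole M-part.\<close>

lemma sat_back_and_forth:
  assumes part: "\<And>X h. S X h \<Longrightarrow> iso L (restrict_struct A X) (restrict_struct B (h ` X)) h"
    and sub: "\<And>X h. S X h \<Longrightarrow> X \<subseteq> univ A \<and> h ` X \<subseteq> univ B"
    and fwd: "\<And>X h a. S X h \<Longrightarrow> a \<in> univ A \<Longrightarrow>
      \<exists>X' h'. S X' h' \<and> X \<subseteq> X' \<and> a \<in> X' \<and> (\<forall>x\<in>X. h' x = h x)"
    and bwd: "\<And>X h b. S X h \<Longrightarrow> b \<in> univ B \<Longrightarrow>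
      \<exists>X' h'. S X' h' \<and> X \<subseteq> X' \<and> b \<in> h' ` X' \<and> (\<forall>x\<in>X. h' x = h x)"
  shows "wf_fm L p \<Longrightarrow> S X h \<Longrightarrow> \<forall>n\<in>free_vars p. e n \<in> X \<and> e' n = h (e n) \<Longrightarrow>
    sat A p e \<longleftrightarrow> sat B p e'"
proof (induction p arbitrary: X h e e')
  case (Eq s t)
  note pi = part[OF Eq.prems(2)]
  have "tm_val A e s \<in> X \<and> tm_val B e' s = h (tm_val A e s)"
    "tm_val A e t \<in> X \<and> tm_val B e' t = h (tm_val A e t)"
    using Eq by (auto intro!: tm_val_iso[OF pi])
  then show ?case
    using isoD(4)[OF pi] by (auto simp: inj_on_def)
next
  case (Rel R ts)
  note pi = part[OF Rel.prems(2)]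
  have ts: "tm_val A e t \<in> X \<and> tm_val B e' t = h (tm_val A e t)" if "t \<in> set ts" for t
    using Rel that by (intro tm_val_iso[OF pi]) auto
  let ?vs = "map (tm_val A e) ts"
  have sub: "set ?vs \<subseteq> X" using ts by auto
  have eq: "map (tm_val B e') ts = map h ?vs" using ts by auto
  have "R \<in> rels L" "length ?vs = rarity L R" using Rel.prems(1) by auto
  then show ?case
    using isoD(7)[OF pi, of R ?vs] sub eq by (simp del: map_map)
next
  case (Neg p)
  then show ?case by simp
next
  case (Conj ps)
  have "sat A (ps i) e \<longleftrightarrow> sat B (ps i) e'" for i
    using Conj.prems by (intro Conj.IH) auto
  then show ?case by simp
next
  case (Ex n p)
  have step: "sat A p (e(n := a)) \<longleftrightarrow> sat B p (e'(n := h' a))"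
    if "S X' h'" "X \<subseteq> X'" "a \<in> X'" "\<forall>x\<in>X. h' x = h x" for X' h' a
    using Ex.prems that by (intro Ex.IH[of X' h']) auto
  show ?case
  proof
    assume "sat A (Ex n p) e"
    then obtain a where a: "a \<in> univ A" "sat A p (e(n := a))" by auto
    obtain X' h' where *: "S X' h'" "X \<subseteq> X'" "a \<in> X'" "\<forall>x\<in>X. h' x = h x"
      using fwd[OF Ex.prems(2) a(1)] by blast
    then have "h' a \<in> univ B" using sub by blast
    then show "sat B (Ex n p) e'" using step[OF *] a(2) by auto
  next
    assume "sat B (Ex n p) e'"
    then obtain b where b: "b \<in> univ B" "sat B p (e'(n := b))" by auto
    obtain X' h' where *: "S X' h'" "X \<subseteq> X'" "b \<in> h' ` X'" "\<forall>x\<in>X. h' x = h x"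
      using bwd[OF Ex.prems(2) b(1)] by blast
    then obtain a where a: "a \<in> X'" "b = h' a" by auto
    then have "a \<in> univ A" using sub *(1) by blast
    then show "sat A (Ex n p) e" using step[OF *(1,2) a(1) *(4)] a(2) b(2) by auto
  qed
qed

lemma is_model_back_and_forth:
  assumes "S X h"
    and "\<And>X h. S X h \<Longrightarrow> iso L (restrict_struct A X) (restrict_struct B (h ` X)) h"
    and "\<And>X h. S X h \<Longrightarrow> X \<subseteq> univ A \<and> h ` X \<subseteq> univ B"
    and "\<And>X h a. S X h \<Longrightarrow> a \<in> univ A \<Longrightarrow>
      \<exists>X' h'. S X' h' \<and> X \<subseteq> X' \<and> a \<in> X' \<and> (\<forall>x\<in>X. h' x = h x)"
    and "\<And>X h b. S X h \<Longrightarrow> b \<in> univ B \<Longrightarrow>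
      \<exists>X' h'. S X' h' \<and> X \<subseteq> X' \<and> b \<in> h' ` X' \<and> (\<forall>x\<in>X. h' x = h x)"
    and "sentence L p" "is_struct L B" "is_model L A p"
  shows "is_model L B p"
proof -
  have p: "wf_fm L p" "free_vars p = {}" using assms(6) by (auto simp: sentence_def)
  obtain a where "a \<in> univ A" using assms(8) by (auto simp: is_model_def is_struct_def)
  then have "sat A p (\<lambda>_. a)" using assms(8) by (auto simp: is_model_def)
  \<comment> \<open>Without free variables the two assignments need not correspond at all.\<close>
  moreover have "sat A p (\<lambda>_. a) \<longleftrightarrow> sat B p e'" for e'
    by (rule sat_back_and_forth[of S, OF assms(2,3,4,5) p(1) assms(1)]) (simp_all add: p(2))
  ultimately show ?thesis using assms(7) by (simp add: is_model_def)
qed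

text \<open>A full isomorphism is by itself a back-and-forth system with a single member.\<close>

lemma is_model_iso:
  assumes "iso L A B h" "sentence L p" "is_model L A p"
  shows "is_model L B p"
proof (rule is_model_back_and_forth[of "\<lambda>X k. X = univ A \<and> k = h"])
  show "iso L (restrict_struct A X) (restrict_struct B (k ` X)) k" if "X = univ A \<and> k = h" for X k
    using that assms(1) isoD(5)[OF assms(1)] by (simp add: iso_def is_struct_def)
qed (use assms isoD(2,5)[OF assms(1)] in auto)

section \<open>Structures whose finite parts lie in the class\<close>

text \<open>For a linear order \<open>lss\<close> the formula says that \<open>xz\<close> is the
  minimum of \<open>xy\<close> and \<open>yz\<close>: the outer two of three consecutive points
  branch where the earlier of the two inner branchings happens.\<close>

definition ordered_ultrametric_triple :: "('m \<Rightarrow> 'm \<Rightarrow> bool) \<Rightarrow> 'm \<Rightarrow> 'm \<Rightarrow> 'm \<Rightarrow> bool" where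
  "ordered_ultrametric_triple lss xy xz yz \<longleftrightarrow>
     (xy = xz \<and> xz = yz) \<or> (xy = xz \<and> lss xz yz) \<or> (xz = yz \<and> lss yz xy)"

text \<open>Membership in the class without countability, finiteness of the V-part and the
  identification of the M-part with \<open>M\<close>. What remains can be checked on finitely many
  elements at a time, so it makes sense for the limit and for uncountable structures.\<close>

locale K_like =
  fixes L0 :: "('f, 'r) lang" and lt :: 'r and A :: "('f, 'r, 'a) xstruct"
  assumes M_struct: "is_struct L0 (Mstruct A)"
    and off_domain: "off_domain_trivial L0 A"
    and V_Un_M: "Vpart A \<union> Mpart A = univ A"
    and V_Int_M: "Vpart A \<inter> Mpart A = {}"
    and tri_linear: "strict_linear_order_on (Vpart A) {(x, y) \<in> Vpart A \<times> Vpart A. tri A x y}"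
    and fval_sym: "\<And>x y. x \<in> Vpart A \<Longrightarrow> y \<in> Vpart A \<Longrightarrow> x \<noteq> y \<Longrightarrow> fval A x y = fval A y x"
    and fval_M: "\<And>x y. x \<in> Vpart A \<Longrightarrow> y \<in> Vpart A \<Longrightarrow> x \<noteq> y \<Longrightarrow> fval A x y \<in> Mpart A"
    and triple: "\<And>x y z. x \<in> Vpart A \<Longrightarrow> y \<in> Vpart A \<Longrightarrow> z \<in> Vpart A \<Longrightarrow>
        x \<noteq> y \<Longrightarrow> y \<noteq> z \<Longrightarrow> x \<noteq> z \<Longrightarrow> tri A x y \<Longrightarrow> tri A y z \<Longrightarrow>
        ordered_ultrametric_triple (\<lambda>u v. rint A (OldR lt) [u, v])
          (fval A x y) (fval A x z) (fval A y z)"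
    and N_V: "\<And>x. x \<in> univ A \<Longrightarrow> rint A SymN [x] \<Longrightarrow> x \<in> Vpart A"

lemma ext_lang_simps [simp]:
  "funs (ext_lang L0) = insert SymF (OldF ` funs L0)"
  "rels (ext_lang L0) = OldR ` rels L0 \<union> {SymV, SymM, SymN, SymTri}"
  "farity (ext_lang L0) (OldF g) = farity L0 g" "farity (ext_lang L0) SymF = 2"
  "rarity (ext_lang L0) (OldR R) = rarity L0 R"
  "rarity (ext_lang L0) SymV = 1" "rarity (ext_lang L0) SymM = 1"
  "rarity (ext_lang L0) SymN = 1" "rarity (ext_lang L0) SymTri = 2"
  by (simp_all add: ext_lang_def)

lemma Mstruct_simps [simp]:
  "univ (Mstruct A) = Mpart A" "fint (Mstruct A) g = fint A (OldF g)"
  "rint (Mstruct A) R = rint A (OldR R)"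
  by (simp_all add: Mstruct_def)

lemma set_subset_imageE:
  assumes "set ys \<subseteq> h ` S"
  obtains xs where "ys = map h xs" "set xs \<subseteq> S"
proof -
  have "ys \<in> map h ` lists S" using assms by (simp flip: lists_image add: in_lists_conv_set subset_eq)
  then show thesis using that by (auto simp: in_lists_conv_set)
qed

lemma length_2_iff: "length xs = 2 \<longleftrightarrow> (\<exists>x y. xs = [x, y])"
  by (cases xs; cases "tl xs") auto

lemma length_1_iff: "length xs = Suc 0 \<longleftrightarrow> (\<exists>x. xs = [x])"
  by (cases xs) auto

section \<open>Substructures that keep the whole M-part\<close>

context K_like
begin

lemma V_sub: "Vpart A \<subseteq> univ A" and M_sub: "Mpart A \<subseteq> univ A"
  using V_Un_M by auto

lemma OldR_M:
  "R \<in> rels L0 \<Longrightarrow> set xs \<subseteq> univ A \<Longrightarrow> length xs = rarity L0 R \<Longrightarrow> rint A (OldR R) xs \<Longrightarrow>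
    set xs \<subseteq> Mpart A"
  using off_domain unfolding off_domain_trivial_def by blast

lemma OldF_hd:
  "g \<in> funs L0 \<Longrightarrow> set xs \<subseteq> univ A \<Longrightarrow> length xs = farity L0 g \<Longrightarrow> \<not> set xs \<subseteq> Mpart A \<Longrightarrow>
    fint A (OldF g) xs = hd xs"
  using off_domain unfolding off_domain_trivial_def by blast

lemma OldF_M:
  "g \<in> funs L0 \<Longrightarrow> set xs \<subseteq> Mpart A \<Longrightarrow> length xs = farity L0 g \<Longrightarrow> fint A (OldF g) xs \<in> Mpart A"
  using fint_in_univ[OF M_struct] by simp

lemma tri_V: "x \<in> univ A \<Longrightarrow> y \<in> univ A \<Longrightarrow> tri A x y \<Longrightarrow> x \<in> Vpart A \<and> y \<in> Vpart A"
  using off_domain unfolding off_domain_trivial_def by blast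

lemma fval_off:
  "x \<in> univ A \<Longrightarrow> y \<in> univ A \<Longrightarrow> \<not> (x \<in> Vpart A \<and> y \<in> Vpart A \<and> x \<noteq> y) \<Longrightarrow> fval A x y = x"
  using off_domain unfolding off_domain_trivial_def by blast

lemma tri_irrefl: "x \<in> Vpart A \<Longrightarrow> \<not> tri A x x"
  using tri_linear unfolding strict_linear_order_on_def irrefl_def by auto

lemma tri_trans:
  "x \<in> Vpart A \<Longrightarrow> y \<in> Vpart A \<Longrightarrow> z \<in> Vpart A \<Longrightarrow> tri A x y \<Longrightarrow> tri A y z \<Longrightarrow> tri A x z"
  using tri_linear unfolding strict_linear_order_on_def trans_def by blast

lemma tri_total: "x \<in> Vpart A \<Longrightarrow> y \<in> Vpart A \<Longrightarrow> x \<noteq> y \<Longrightarrow> tri A x y \<or> tri A y x"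
  using tri_linear unfolding strict_linear_order_on_def total_on_def by auto

text \<open>No symbol produces a new element of V: on its intended domain its value lies in M, and
  elsewhere it returns its first argument.\<close>

lemma closed_Un_M:
  assumes "X \<subseteq> Vpart A"
  shows "closed_in (ext_lang L0) A (X \<union> Mpart A)"
  unfolding closed_in_def
proof (intro ballI allI impI, elim conjE)
  fix g xs
  assume g: "g \<in> funs (ext_lang L0)"
    and xs: "set xs \<subseteq> X \<union> Mpart A" and len: "length xs = farity (ext_lang L0) g"
  have xs': "set xs \<subseteq> univ A" using xs assms V_sub M_sub by blast
  show "fint A g xs \<in> X \<union> Mpart A"
  proof (cases g)
    case (OldF g0)
    then have g0: "g0 \<in> funs L0" "length xs = farity L0 g0" using g len by auto
    show ?thesis
    proof (cases "set xs \<subseteq> Mpart A")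
      case True
      then show ?thesis using OldF_M g0 OldF by blast
    next
      case False
      \<comment> \<open>An empty tuple would lie in M, so the symbol is not a constant here and the
        head exists.\<close>
      then have "hd xs \<in> set xs" by (auto intro: hd_in_set)
      then show ?thesis using OldF_hd[OF g0(1) xs' g0(2) False] OldF xs by auto
    qed
  next
    case SymF
    then obtain x y where xy: "xs = [x, y]" using len by (auto simp: length_2_iff)
    then show ?thesis
      using fval_off[of x y] fval_M[of x y] xs xs' SymF
      by (cases "x \<in> Vpart A \<and> y \<in> Vpart A \<and> x \<noteq> y") auto
  qed
qed

lemma M_nonempty: "Mpart A \<noteq> {}"
  using M_struct by (simp add: is_struct_def)

lemma is_struct_restrict:
  "X \<subseteq> Vpart A \<Longrightarrow> is_struct (ext_lang L0) (restrict_struct A (X \<union> Mpart A))"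
  using closed_Un_M M_nonempty by (simp add: is_struct_def)

lemma is_struct_ext: "is_struct (ext_lang L0) A"
  using closed_Un_M[of "Vpart A"] V_Un_M M_nonempty M_sub by (auto simp: is_struct_def)

lemma parts_restrict:
  assumes "X \<subseteq> Vpart A"
  shows "Vpart (restrict_struct A (X \<union> Mpart A)) = X"
    "Mpart (restrict_struct A (X \<union> Mpart A)) = Mpart A"
  using assms V_Int_M by (auto simp: Vpart_def Mpart_def)

lemma K_like_restrict:
  assumes "X \<subseteq> Vpart A"
  shows "K_like L0 lt (restrict_struct A (X \<union> Mpart A))"
proof -
  let ?B = "restrict_struct A (X \<union> Mpart A)"
  note parts = parts_restrict[OF assms]
  have sub: "X \<union> Mpart A \<subseteq> univ A" using assms V_sub M_sub by blast
  show ?thesis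
  proof
    have "Mstruct ?B = Mstruct A" by (simp add: Mstruct_def parts)
    then show "is_struct L0 (Mstruct ?B)" using M_struct by simp
    have V: "x \<in> Vpart A \<longleftrightarrow> x \<in> X" if "x \<in> X \<union> Mpart A" for x
      using that assms V_Int_M by auto
    show "off_domain_trivial L0 ?B"
      unfolding off_domain_trivial_def parts
    proof (intro conjI ballI allI impI; (elim conjE)?)
      fix R xs assume "R \<in> rels L0" "set xs \<subseteq> univ ?B" "length xs = rarity L0 R" "rint ?B (OldR R) xs"
      then show "set xs \<subseteq> Mpart A" using OldR_M[of R xs] sub by auto
    next
      fix g xs assume "g \<in> funs L0" "set xs \<subseteq> univ ?B" "length xs = farity L0 g" "\<not> set xs \<subseteq> Mpart A"
      then show "fint ?B (OldF g) xs = hd xs" using OldF_hd[of g xs] sub by auto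
    next
      fix x y assume "x \<in> univ ?B" "y \<in> univ ?B" "tri ?B x y"
      then show "x \<in> X" "y \<in> X" using tri_V[of x y] sub V[of x] V[of y] by auto
    next
      fix x y assume "x \<in> univ ?B" "y \<in> univ ?B" "\<not> (x \<in> X \<and> y \<in> X \<and> x \<noteq> y)"
      then show "fval ?B x y = x" using fval_off[of x y] sub V[of x] V[of y] by auto
    qed
    show "strict_linear_order_on (Vpart ?B) {(x, y) \<in> Vpart ?B \<times> Vpart ?B. tri ?B x y}"
      unfolding parts strict_linear_order_on_def trans_def irrefl_def total_on_def
    proof (intro conjI allI impI ballI)
      show "(x, z) \<in> {(x, y) \<in> X \<times> X. tri ?B x y}"
        if "(x, y) \<in> {(x, y) \<in> X \<times> X. tri ?B x y}" "(y, z) \<in> {(x, y) \<in> X \<times> X. tri ?B x y}"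
        for x y z
        using that assms tri_trans[of x y z] by auto
      show "(x, x) \<notin> {(x, y) \<in> X \<times> X. tri ?B x y}" for x
        using assms tri_irrefl[of x] by auto
      show "(x, y) \<in> {(x, y) \<in> X \<times> X. tri ?B x y} \<or> (y, x) \<in> {(x, y) \<in> X \<times> X. tri ?B x y}"
        if "x \<in> X" "y \<in> X" "x \<noteq> y" for x y
        using that assms tri_total[of x y] by auto
    qed
    show "ordered_ultrametric_triple (\<lambda>u v. rint ?B (OldR lt) [u, v])
          (fval ?B x y) (fval ?B x z) (fval ?B y z)"
      if "x \<in> Vpart ?B" "y \<in> Vpart ?B" "z \<in> Vpart ?B" "x \<noteq> y" "y \<noteq> z" "x \<noteq> z"
        "tri ?B x y" "tri ?B y z" for x y z
      using that assms triple[of x y z] by (auto simp: parts)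
    show "fval ?B x y = fval ?B y x"
      if "x \<in> Vpart ?B" "y \<in> Vpart ?B" "x \<noteq> y" for x y
      using that assms fval_sym[of x y] by (auto simp: parts)
    show "fval ?B x y \<in> Mpart ?B"
      if "x \<in> Vpart ?B" "y \<in> Vpart ?B" "x \<noteq> y" for x y
      using that assms fval_M[of x y] by (auto simp: parts)
    show "x \<in> Vpart ?B" if "x \<in> univ ?B" "rint ?B SymN [x]" for x
      using that sub N_V[of x] V[of x] unfolding parts by auto
  qed (use parts assms V_Int_M in auto)
qed

end

lemma in_K_iff:
  "in_K L0 lt M A \<longleftrightarrow>
     K_like L0 lt A \<and> countable (univ A) \<and> finite (Vpart A) \<and> isomorphic L0 (Mstruct A) M"
proof
  assume "in_K L0 lt M A"
  then show "K_like L0 lt A \<and> countable (univ A) \<and> finite (Vpart A) \<and> isomorphic L0 (Mstruct A) M"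
    unfolding in_K_def K_like_def ordered_ultrametric_triple_def
    by (simp add: isomorphic_def iso_def)
next
  assume *: "K_like L0 lt A \<and> countable (univ A) \<and> finite (Vpart A) \<and> isomorphic L0 (Mstruct A) M"
  then interpret K_like L0 lt A by simp
  show "in_K L0 lt M A"
    unfolding in_K_def
    using * is_struct_ext off_domain V_Un_M V_Int_M tri_linear fval_sym fval_M
      triple[unfolded ordered_ultrametric_triple_def] N_V by simp
qed

section \<open>Invariance of the class under isomorphism\<close>

lemma iso_extD:
  assumes "iso (ext_lang L0) A B h"
  shows "\<And>x. x \<in> univ A \<Longrightarrow> h x \<in> Vpart B \<longleftrightarrow> x \<in> Vpart A"
    "\<And>x. x \<in> univ A \<Longrightarrow> h x \<in> Mpart B \<longleftrightarrow> x \<in> Mpart A"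
    "\<And>x. x \<in> univ A \<Longrightarrow> rint B SymN [h x] \<longleftrightarrow> rint A SymN [x]"
    "\<And>x y. x \<in> univ A \<Longrightarrow> y \<in> univ A \<Longrightarrow> tri B (h x) (h y) \<longleftrightarrow> tri A x y"
    "\<And>x y. x \<in> univ A \<Longrightarrow> y \<in> univ A \<Longrightarrow> fval B (h x) (h y) = h (fval A x y)"
    "h ` Vpart A = Vpart B" "h ` Mpart A = Mpart B"
proof -
  note h = isoD[OF assms]
  show V: "h x \<in> Vpart B \<longleftrightarrow> x \<in> Vpart A" if "x \<in> univ A" for x
    using that h(5) h(7)[of SymV "[x]"] by (auto simp: Vpart_def)
  show M: "h x \<in> Mpart B \<longleftrightarrow> x \<in> Mpart A" if "x \<in> univ A" for x
    using that h(5) h(7)[of SymM "[x]"] by (auto simp: Mpart_def)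
  show "rint B SymN [h x] \<longleftrightarrow> rint A SymN [x]" if "x \<in> univ A" for x
    using that h(7)[of SymN "[x]"] by auto
  show "tri B (h x) (h y) \<longleftrightarrow> tri A x y" if "x \<in> univ A" "y \<in> univ A" for x y
    using that h(7)[of SymTri "[x, y]"] by auto
  show "fval B (h x) (h y) = h (fval A x y)" if "x \<in> univ A" "y \<in> univ A" for x y
    using that h(6)[of SymF "[x, y]"] by auto
  have "Vpart B \<subseteq> h ` univ A" "Mpart B \<subseteq> h ` univ A" "Vpart A \<subseteq> univ A" "Mpart A \<subseteq> univ A"
    using h(5) by (auto simp: Vpart_def Mpart_def)
  then show "h ` Vpart A = Vpart B" "h ` Mpart A = Mpart B"
    using V M by blast+
qed

text \<open>That \<open>Mpart B\<close> is closed under the old functions has to be derived: every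
  tuple over it is the image of a tuple over \<open>Mpart A\<close>.\<close>

lemma iso_Mstruct:
  assumes "iso (ext_lang L0) A B h" "is_struct L0 (Mstruct A)"
  shows "iso L0 (Mstruct A) (Mstruct B) h"
proof -
  note h = isoD[OF assms(1)] and e = iso_extD[OF assms(1)]
  have sub: "Mpart A \<subseteq> univ A" by (auto simp: Mpart_def)
  have f: "h (fint A (OldF g) xs) = fint B (OldF g) (map h xs)"
    if "g \<in> funs L0" "set xs \<subseteq> Mpart A" "length xs = farity L0 g" for g xs
    using h(6)[of "OldF g" xs] that sub by auto
  have r: "rint A (OldR R) xs \<longleftrightarrow> rint B (OldR R) (map h xs)"
    if "R \<in> rels L0" "set xs \<subseteq> Mpart A" "length xs = rarity L0 R" for R xs
    using h(7)[of "OldR R" xs] that sub by auto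
  have "fint B (OldF g) ys \<in> Mpart B"
    if "g \<in> funs L0" "set ys \<subseteq> Mpart B" "length ys = farity L0 g" for g ys
  proof -
    obtain xs where xs: "ys = map h xs" "set xs \<subseteq> Mpart A"
      using \<open>set ys \<subseteq> Mpart B\<close> unfolding e(7)[symmetric] by (blast elim: set_subset_imageE)
    then have "fint A (OldF g) xs \<in> Mpart A"
      using that fint_in_univ[OF assms(2)] by simp
    then have "h (fint A (OldF g) xs) \<in> Mpart B" using e(7) by blast
    then show ?thesis using f[of g xs] xs that by simp
  qed
  then have "is_struct L0 (Mstruct B)"
    using assms(2) e(7) by (auto simp: is_struct_def closed_in_def)
  moreover have "bij_betw h (Mpart A) (Mpart B)"
    using h(4) e(7) sub by (auto simp: bij_betw_def intro: inj_on_subset)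
  ultimately show ?thesis
    using assms(2) f r by (simp add: iso_def)
qed

text \<open>The condition on triples mentions \<open>lt\<close>, and an isomorphism respects
  \<open>lt\<close> on pairs only if it is a binary symbol of the language; hence the last
  assumption.\<close>

lemma in_K_iso:
  assumes "in_K L0 lt M A" and h: "iso (ext_lang L0) A B h" and lt: "lt \<in> rels L0" "rarity L0 lt = 2"
  shows "in_K L0 lt M B"
proof -
  have A: "K_like L0 lt A" "countable (univ A)" "finite (Vpart A)" "isomorphic L0 (Mstruct A) M"
    using assms(1) by (auto simp: in_K_iff)
  interpret K_like L0 lt A by fact
  note i = isoD[OF h] and e = iso_extD[OF h]
  note isoM = iso_Mstruct[OF h M_struct]
  have uB: "univ B = h ` univ A" using i(5) by simp
  have lists: "\<exists>xs. ys = map h xs \<and> set xs \<subseteq> univ A" if "set ys \<subseteq> univ B" for ys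
    using that unfolding uB by (blast elim: set_subset_imageE)
  have subM: "set (map h xs) \<subseteq> Mpart B \<longleftrightarrow> set xs \<subseteq> Mpart A" if "set xs \<subseteq> univ A" for xs
    using that e(2) by auto
  have inj: "h x = h y \<longleftrightarrow> x = y" if "x \<in> univ A" "y \<in> univ A" for x y
    using that i(4) by (auto simp: inj_on_def)
  have V: "x \<in> univ A" if "x \<in> Vpart A" for x using that V_sub by auto
  have M: "x \<in> univ A" if "x \<in> Mpart A" for x using that M_sub by auto
  have "K_like L0 lt B"
  proof
    show "is_struct L0 (Mstruct B)" using isoD(2)[OF isoM] .
    show "off_domain_trivial L0 B"
      unfolding off_domain_trivial_def
    proof (intro conjI ballI allI impI; (elim conjE)?)
      fix R ys assume *: "R \<in> rels L0" "set ys \<subseteq> univ B" "length ys = rarity L0 R" "rint B (OldR R) ys"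
      then obtain xs where xs: "ys = map h xs" "set xs \<subseteq> univ A" using lists by blast
      then have "rint A (OldR R) xs" using i(7)[of "OldR R" xs] * by auto
      then show "set ys \<subseteq> Mpart B" using OldR_M[of R xs] * xs subM by auto
    next
      fix g ys assume *: "g \<in> funs L0" "set ys \<subseteq> univ B" "length ys = farity L0 g" "\<not> set ys \<subseteq> Mpart B"
      then obtain xs where xs: "ys = map h xs" "set xs \<subseteq> univ A" using lists by blast
      then have "fint A (OldF g) xs = hd xs" using OldF_hd[of g xs] subM[of xs] * by auto
      moreover have "xs \<noteq> []" using * xs by auto
      ultimately show "fint B (OldF g) ys = hd ys"
        using i(6)[of "OldF g" xs] * xs by (auto simp: hd_map)
    next
      fix x y assume "x \<in> univ B" "y \<in> univ B" "tri B x y"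
      then show "x \<in> Vpart B" "y \<in> Vpart B" using tri_V e(1,4) unfolding uB by auto
    next
      fix x y assume *: "x \<in> univ B" "y \<in> univ B" "\<not> (x \<in> Vpart B \<and> y \<in> Vpart B \<and> x \<noteq> y)"
      then obtain x' y' where "x = h x'" "y = h y'" "x' \<in> univ A" "y' \<in> univ A"
        unfolding uB by auto
      then show "fval B x y = x" using *(3) fval_off[of x' y'] e(1,5) inj by auto
    qed
    show "Vpart B \<union> Mpart B = univ B" unfolding uB V_Un_M[symmetric] image_Un e(6,7) ..
    show "Vpart B \<inter> Mpart B = {}"
      using V_Int_M e(2) V_sub unfolding e(6)[symmetric] by auto
    show "strict_linear_order_on (Vpart B) {(x, y) \<in> Vpart B \<times> Vpart B. tri B x y}"
      unfolding strict_linear_order_on_def trans_def irrefl_def total_on_def e(6)[symmetric]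
    proof (intro conjI allI impI ballI)
      show "(x, z) \<in> {(x, y) \<in> h ` Vpart A \<times> h ` Vpart A. tri B x y}"
        if "(x, y) \<in> {(x, y) \<in> h ` Vpart A \<times> h ` Vpart A. tri B x y}"
          "(y, z) \<in> {(x, y) \<in> h ` Vpart A \<times> h ` Vpart A. tri B x y}" for x y z
        using that e(4) V inj by (auto intro: tri_trans)
    next
      fix x y assume "x \<in> h ` Vpart A" "y \<in> h ` Vpart A" "x \<noteq> y"
      then show "(x, y) \<in> {(x, y) \<in> h ` Vpart A \<times> h ` Vpart A. tri B x y} \<or>
          (y, x) \<in> {(x, y) \<in> h ` Vpart A \<times> h ` Vpart A. tri B x y}"
        using e(4) V tri_total by fastforce
    qed (use e(4) V tri_irrefl in auto)
    show "fval B x y = fval B y x" "fval B x y \<in> Mpart B"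
      if "x \<in> Vpart B" "y \<in> Vpart B" "x \<noteq> y" for x y
      using that fval_sym fval_M e(5) V inj M e(2) unfolding e(6)[symmetric] by auto
    show "ordered_ultrametric_triple (\<lambda>u v. rint B (OldR lt) [u, v])
          (fval B x y) (fval B x z) (fval B y z)"
      if V3: "x \<in> Vpart B" "y \<in> Vpart B" "z \<in> Vpart B" and "x \<noteq> y" "y \<noteq> z" "x \<noteq> z"
        "tri B x y" "tri B y z" for x y z
    proof -
      obtain x' y' z' where xyz: "x = h x'" "y = h y'" "z = h z'"
        "x' \<in> Vpart A" "y' \<in> Vpart A" "z' \<in> Vpart A" using V3 e(6) by blast
      have *: "ordered_ultrametric_triple (\<lambda>u v. rint A (OldR lt) [u, v])
          (fval A x' y') (fval A x' z') (fval A y' z')"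
        using that xyz e(4) V by (intro triple) auto
      have M: "fval A x' y' \<in> univ A" "fval A x' z' \<in> univ A" "fval A y' z' \<in> univ A"
        using fval_M xyz that M by blast+
      have "rint B (OldR lt) [h u, h v] \<longleftrightarrow> rint A (OldR lt) [u, v]"
        if "u \<in> univ A" "v \<in> univ A" for u v
        using i(7)[of "OldR lt" "[u, v]"] that lt by simp
      then show ?thesis
        using * M xyz V e(5) inj by (simp add: ordered_ultrametric_triple_def)
    qed
    show "x \<in> Vpart B" if "x \<in> univ B" "rint B SymN [x]" for x
      using that N_V e(3) e(1) unfolding uB by auto
  qed
  moreover have "countable (univ B)" "finite (Vpart B)"
    using A uB e(6) by (metis countable_image, metis finite_imageI)
  moreover have "isomorphic L0 (Mstruct B) M"
    using A(4) iso_comp[OF iso_inv[OF isoM]] unfolding isomorphic_def by blast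
  ultimately show ?thesis by (simp add: in_K_iff)
qed

section \<open>Partial isomorphisms over the M-part\<close>

text \<open>The map is meant on \<open>X \<union> Mpart A\<close>, but only its V-part
  \<open>X\<close> is recorded. Equal arguments are excluded because the conventions off the
  intended domain settle them. The following lemmas identify these maps with isomorphisms of
  substructures, so that extending one by a point needs no argument about closure.\<close>

definition K_map ::
  "('f, 'r) lang \<Rightarrow> ('f, 'r, 'a) xstruct \<Rightarrow> ('f, 'r, 'b) xstruct \<Rightarrow> 'a set \<Rightarrow> ('a \<Rightarrow> 'b) \<Rightarrow> bool" where
  "K_map L0 A B X h \<longleftrightarrow>
     X \<subseteq> Vpart A \<and> h ` X \<subseteq> Vpart B \<and> inj_on h X \<and> iso L0 (Mstruct A) (Mstruct B) h \<and>
     (\<forall>x\<in>X. rint A SymN [x] \<longleftrightarrow> rint B SymN [h x]) \<and>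
     (\<forall>x\<in>X. \<forall>y\<in>X. x \<noteq> y \<longrightarrow>
        (tri A x y \<longleftrightarrow> tri B (h x) (h y)) \<and> h (fval A x y) = fval B (h x) (h y))"

lemma K_mapD:
  assumes "K_map L0 A B X h"
  shows "X \<subseteq> Vpart A" "h ` X \<subseteq> Vpart B" "inj_on h X" "iso L0 (Mstruct A) (Mstruct B) h"
    "\<And>x. x \<in> X \<Longrightarrow> rint A SymN [x] \<longleftrightarrow> rint B SymN [h x]"
    "\<And>x y. x \<in> X \<Longrightarrow> y \<in> X \<Longrightarrow> x \<noteq> y \<Longrightarrow> tri A x y \<longleftrightarrow> tri B (h x) (h y)"
    "\<And>x y. x \<in> X \<Longrightarrow> y \<in> X \<Longrightarrow> x \<noteq> y \<Longrightarrow> h (fval A x y) = fval B (h x) (h y)"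
  using assms unfolding K_map_def by blast+

text \<open>All values not mentioned in \<open>K_map\<close> are fixed by the conventions off the
  domain, which hold on both sides; \<open>h\<close> respects the division into V and M, so the same
  convention applies to a tuple and to its image.\<close>

lemma K_map_iso:
  assumes "K_like L0 lt A" "K_like L0 lt B" and map: "K_map L0 A B X h"
  shows "iso (ext_lang L0) (restrict_struct A (X \<union> Mpart A))
    (restrict_struct B (h ` X \<union> Mpart B)) h"
proof -
  interpret A: K_like L0 lt A by fact
  interpret B: K_like L0 lt B by fact
  note X = K_mapD(1)[OF map] and hX = K_mapD(2)[OF map] and inj = K_mapD(3)[OF map]
    and isoM = K_mapD(4)[OF map] and N = K_mapD(5)[OF map] and tri = K_mapD(6)[OF map]
    and f = K_mapD(7)[OF map]
  note i = isoD[OF isoM, simplified]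
  let ?X = "X \<union> Mpart A" and ?Y = "h ` X \<union> Mpart B"
  have subA: "?X \<subseteq> univ A" using X A.V_sub A.M_sub by blast
  have subB: "?Y \<subseteq> univ B" using hX B.V_sub B.M_sub by blast
  have hM: "h x \<in> Mpart B \<longleftrightarrow> x \<in> Mpart A" if "x \<in> ?X" for x
    using that i(5) hX B.V_Int_M by auto
  have hV: "h x \<in> Vpart B \<longleftrightarrow> x \<in> X" if "x \<in> ?X" for x
    using that i(5) hX B.V_Int_M hM A.V_Int_M X by auto
  have VX: "x \<in> Vpart A \<longleftrightarrow> x \<in> X" if "x \<in> ?X" for x
    using that A.V_Int_M X by auto
  have injX: "inj_on h ?X"
    unfolding inj_on_Un
  proof (intro conjI inj i(4))
    show "h ` (X - Mpart A) \<inter> h ` (Mpart A - X) = {}"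
      using hX i(5) B.V_Int_M by fast
  qed
  have bij: "bij_betw h ?X ?Y"
    using injX i(5) by (auto simp: bij_betw_def)
  have hs: "set (map h xs) \<subseteq> univ B" if "set xs \<subseteq> ?X" for xs
    using that subB bij_betw_imp_surj_on[OF bij] unfolding set_map by blast
  have hsM: "set (map h xs) \<subseteq> Mpart B \<longleftrightarrow> set xs \<subseteq> Mpart A" if "set xs \<subseteq> ?X" for xs
    using that hM by auto
  have funs: "h (fint A g xs) = fint B g (map h xs)"
    if g: "g \<in> funs (ext_lang L0)" "set xs \<subseteq> ?X" "length xs = farity (ext_lang L0) g" for g xs
  proof (cases g)
    case (OldF g0)
    then have g0: "g0 \<in> funs L0" "length xs = farity L0 g0" using that by auto
    show ?thesis
    proof (cases "set xs \<subseteq> Mpart A")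
      case True
      then show ?thesis using i(6)[of g0 xs] g0 OldF by simp
    next
      case False
      then have ne: "xs \<noteq> []" by auto
      have "fint A (OldF g0) xs = hd xs"
        using A.OldF_hd g0 that subA False by blast
      moreover have "fint B (OldF g0) (map h xs) = hd (map h xs)"
        using B.OldF_hd[of g0 "map h xs"] g0 hs[OF that(2)] hsM[OF that(2)] False by simp
      ultimately show ?thesis using OldF ne by (simp add: hd_map)
    qed
  next
    case SymF
    then obtain x y where xs: "xs = [x, y]" using g by (auto simp: length_2_iff)
    have xy: "x \<in> ?X" "y \<in> ?X" using that xs by auto
    then have hxy: "h x \<in> univ B" "h y \<in> univ B" using hs[of xs] that(2) xs by auto
    have eq: "h x = h y \<longleftrightarrow> x = y" using injX xy by (auto simp: inj_on_def)
    have "h (fval A x y) = fval B (h x) (h y)"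
    proof (cases "x \<in> X \<and> y \<in> X \<and> x \<noteq> y")
      case True
      then show ?thesis using f by auto
    next
      case False
      then have "fval A x y = x" using A.fval_off[of x y] xy subA VX by blast
      moreover have "fval B (h x) (h y) = h x"
        using B.fval_off[OF hxy] hV[OF xy(1)] hV[OF xy(2)] False eq by blast
      ultimately show ?thesis by simp
    qed
    then show ?thesis using SymF xs by simp
  qed
  have rels: "rint A R xs \<longleftrightarrow> rint B R (map h xs)"
    if R: "R \<in> rels (ext_lang L0)" "set xs \<subseteq> ?X" "length xs = rarity (ext_lang L0) R" for R xs
  proof (cases R)
    case (OldR R0)
    then have R0: "R0 \<in> rels L0" "length xs = rarity L0 R0" using that by auto
    show ?thesis
    proof (cases "set xs \<subseteq> Mpart A")
      case True
      then show ?thesis using i(7)[of R0 xs] R0 OldR by simp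
    next
      case False
      have "\<not> rint A (OldR R0) xs" using A.OldR_M[of R0 xs] R0 that subA False by blast
      moreover have "\<not> rint B (OldR R0) (map h xs)"
        using B.OldR_M[of R0 "map h xs"] R0 hs[OF that(2)] hsM[OF that(2)] False by auto
      ultimately show ?thesis using OldR by simp
    qed
  next
    case SymV
    then obtain x where "xs = [x]" using R by (auto simp: length_1_iff)
    then show ?thesis
      using SymV that(2) hV[of x] VX[of x] hs[of xs] subA by (auto simp: Vpart_def)
  next
    case SymM
    then obtain x where "xs = [x]" using R by (auto simp: length_1_iff)
    then show ?thesis
      using SymM that(2) hM[of x] hs[of xs] subA by (auto simp: Mpart_def)
  next
    case SymN
    then obtain x where x: "xs = [x]" using R by (auto simp: length_1_iff)
    have "x \<in> X" if "rint A SymN [x] \<or> rint B SymN [h x]"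
      using that A.N_V[of x] B.N_V[of "h x"] x \<open>set xs \<subseteq> ?X\<close> hs[of xs] subA hV[of x] VX[of x] by auto
    then show ?thesis using SymN x N[of x] by auto
  next
    case SymTri
    then obtain x y where xs: "xs = [x, y]" using R by (auto simp: length_2_iff)
    have xy: "x \<in> ?X" "y \<in> ?X" using that xs by auto
    then have hxy: "h x \<in> univ B" "h y \<in> univ B" using hs[of xs] that(2) xs by auto
    have "x \<in> X \<and> y \<in> X \<and> x \<noteq> y" if "tri A x y"
      using that A.tri_V[of x y] A.tri_irrefl xy VX subA by blast
    moreover have "x \<in> X \<and> y \<in> X \<and> x \<noteq> y" if "tri B (h x) (h y)"
      using that B.tri_V[OF hxy] B.tri_irrefl xy hV by blast
    ultimately show ?thesis using SymTri xs tri[of x y] by auto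
  qed
  show ?thesis
    unfolding iso_def
    using A.is_struct_restrict[OF X] B.is_struct_restrict[OF hX] bij funs rels by simp
qed

lemma iso_K_map:
  assumes "K_like L0 lt A" "K_like L0 lt B" "X \<subseteq> Vpart A" "Y \<subseteq> Vpart B"
    and h: "iso (ext_lang L0) (restrict_struct A (X \<union> Mpart A)) (restrict_struct B (Y \<union> Mpart B)) h"
  shows "K_map L0 A B X h" "h ` X = Y"
proof -
  interpret A: K_like L0 lt A by fact
  interpret B: K_like L0 lt B by fact
  note pA = A.parts_restrict[OF assms(3)] and pB = B.parts_restrict[OF assms(4)]
  note e = iso_extD[OF h, unfolded pA pB, simplified]
  have MA: "Mstruct (restrict_struct A (X \<union> Mpart A)) = Mstruct A"
    by (simp add: Mstruct_def pA)
  have MB: "Mstruct (restrict_struct B (Y \<union> Mpart B)) = Mstruct B"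
    by (simp add: Mstruct_def pB)
  have "iso L0 (Mstruct A) (Mstruct B) h"
    using iso_Mstruct[OF h] A.M_struct unfolding MA MB by simp
  moreover have "inj_on h X" using isoD(4)[OF h] by (auto intro: inj_on_subset)
  ultimately show "K_map L0 A B X h"
    unfolding K_map_def using assms(3,4) e by auto
  show "h ` X = Y" by (rule e(6))
qed

lemma K_map_mono: "K_map L0 A B X h \<Longrightarrow> Y \<subseteq> X \<Longrightarrow> K_map L0 A B Y h"
  unfolding K_map_def by (elim conjE, intro conjI) (blast intro: inj_on_subset)+

lemma K_map_comp:
  assumes h: "K_map L0 A B X h" and k: "K_map L0 B C (h ` X) k"
  shows "K_map L0 A C X (k \<circ> h)"
proof -
  note h = K_mapD[OF h] and k = K_mapD[OF k]
  have ne: "h x \<noteq> h y" if "x \<in> X" "y \<in> X" "x \<noteq> y" for x y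
    using h(3) that by (auto simp: inj_on_def)
  show ?thesis
    unfolding K_map_def
  proof (intro conjI ballI impI)
    show "iso L0 (Mstruct A) (Mstruct C) (k \<circ> h)" using h(4) k(4) by (rule iso_comp)
    fix x y assume xy: "x \<in> X" "y \<in> X" "x \<noteq> y"
    show "tri A x y \<longleftrightarrow> tri C ((k \<circ> h) x) ((k \<circ> h) y)"
      using h(6)[OF xy] k(6)[OF imageI imageI ne, OF xy(1,2) xy] by simp
    show "(k \<circ> h) (fval A x y) = fval C ((k \<circ> h) x) ((k \<circ> h) y)"
      using h(7)[OF xy] k(7)[OF imageI imageI ne, OF xy(1,2) xy] by simp
  qed (use h(1,2,3,5) k(1,2,3,5) in \<open>auto intro: comp_inj_on\<close>)
qed

text \<open>It is enough to control pairs whose second entry is the new point: symmetry of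
  \<open>f\<close> and linearity of \<triangleleft> give the reversed pairs. Changing
  \<open>h\<close> at \<open>x\<close> leaves its M-part alone, because \<open>x\<close> is in
  V.\<close>

lemma K_map_extend:
  assumes "K_like L0 lt A" "K_like L0 lt B" and map: "K_map L0 A B X h"
    and x: "x \<in> Vpart A" "x \<notin> X" and y: "y \<in> Vpart B" "y \<notin> h ` X"
    and N: "rint A SymN [x] \<longleftrightarrow> rint B SymN [y]"
    and tri: "\<And>a. a \<in> X \<Longrightarrow> tri A a x \<longleftrightarrow> tri B (h a) y"
    and f: "\<And>a. a \<in> X \<Longrightarrow> h (fval A a x) = fval B (h a) y"
  shows "K_map L0 A B (insert x X) (h(x := y))"
proof -
  interpret A: K_like L0 lt A by fact
  interpret B: K_like L0 lt B by fact
  note h = K_mapD[OF map]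
  let ?k = "h(x := y)"
  have asym: "tri A b a \<longleftrightarrow> \<not> tri A a b" if "a \<in> Vpart A" "b \<in> Vpart A" "a \<noteq> b" for a b
    using that A.tri_total A.tri_irrefl A.tri_trans by blast
  have asymB: "tri B b a \<longleftrightarrow> \<not> tri B a b" if "a \<in> Vpart B" "b \<in> Vpart B" "a \<noteq> b" for a b
    using that B.tri_total B.tri_irrefl B.tri_trans by blast
  have k_eq: "?k z = h z" if "z \<in> X \<union> Mpart A" for z
    using that x A.V_Int_M by auto
  have fM: "fval A a b \<in> X \<union> Mpart A" if "a \<in> insert x X" "b \<in> insert x X" "a \<noteq> b" for a b
    using that h(1) x A.fval_M by blast
  show ?thesis
    unfolding K_map_def
  proof (intro conjI ballI impI)
    show "iso L0 (Mstruct A) (Mstruct B) ?k"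
      by (rule iso_cong[OF h(4)]) (use k_eq in auto)
    show "inj_on ?k (insert x X)"
      using h(3) x y by (auto simp: inj_on_def)
    show "rint A SymN [a] \<longleftrightarrow> rint B SymN [?k a]" if "a \<in> insert x X" for a
      using that N h(5)[of a] by auto
    fix a b assume ab: "a \<in> insert x X" "b \<in> insert x X" "a \<noteq> b"
    then consider "a \<in> X" "b \<in> X" "a \<noteq> x" "b \<noteq> x" | "a = x" "b \<in> X" "b \<noteq> x"
      | "a \<in> X" "b = x" "a \<noteq> x"
      using x by auto
    then have "(tri A a b \<longleftrightarrow> tri B (?k a) (?k b)) \<and> h (fval A a b) = fval B (?k a) (?k b)"
    proof cases
      case 1
      then show ?thesis using h(6,7)[of a b] ab(3) by simp
    next
      case 2
      then have "b \<in> Vpart A" "h b \<in> Vpart B" "h b \<noteq> y" using h(1,2) y by auto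
      then show ?thesis
        using tri[of b] f[of b] 2 x y asym[of b x] asymB[of "h b" y]
          A.fval_sym[of x b] B.fval_sym[of y "h b"] by auto
    next
      case 3
      then show ?thesis using tri[of a] f[of a] by simp
    qed
    then show "tri A a b \<longleftrightarrow> tri B (?k a) (?k b)" "?k (fval A a b) = fval B (?k a) (?k b)"
      using k_eq[OF fM[OF ab]] by simp_all
  qed (use h(1,2) x y in auto)
qed

section \<open>The limit\<close>

lemma restrict_struct_univ: "restrict_struct A (univ A) = A"
  by (simp add: restrict_struct_def)

lemma fraisse_limitD:
  fixes C :: "('f, 'r, nat) xstruct" and F :: "('f, 'r, 'a) xstruct"
  assumes "fraisse_limit L0 lt M F"
  shows "is_struct (ext_lang L0) F" "countable (univ F)" "isomorphic L0 (Mstruct F) M"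
    "finite A0 \<Longrightarrow> A0 \<subseteq> univ F \<Longrightarrow> in_K L0 lt M (fg_over_M L0 F A0)"
    "in_K L0 lt M C \<Longrightarrow>
      \<exists>A0. finite A0 \<and> A0 \<subseteq> univ F \<and> isomorphic (ext_lang L0) C (fg_over_M L0 F A0)"
    "finite A0 \<Longrightarrow> A0 \<subseteq> univ F \<Longrightarrow> finite B0 \<Longrightarrow> B0 \<subseteq> univ F \<Longrightarrow>
      iso (ext_lang L0) (fg_over_M L0 F A0) (fg_over_M L0 F B0) h \<Longrightarrow>
      \<exists>g. iso (ext_lang L0) F F g \<and> (\<forall>x\<in>univ (fg_over_M L0 F A0). g x = h x)"
  using assms by (simp_all add: fraisse_limit_def)

text \<open>Each condition concerns a finite tuple, and the tuple lies in the substructure it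
  generates over M, which is a member of the class with the same M-part.\<close>

lemma fraisse_limit_K_like:
  assumes "fraisse_limit L0 lt M F"
  shows "K_like L0 lt F"
proof -
  define U where "U A0 = generated (ext_lang L0) F A0 \<union> Mpart F" for A0
  have struct: "is_struct (ext_lang L0) F" and isoM: "isomorphic L0 (Mstruct F) M"
    and K: "\<And>A0. finite A0 \<Longrightarrow> A0 \<subseteq> univ F \<Longrightarrow> in_K L0 lt M (restrict_struct F (U A0))"
    using fraisse_limitD[OF assms] by (simp_all add: fg_over_M_def U_def)
  have K: "K_like L0 lt (restrict_struct F (U A0))" if "finite A0" "A0 \<subseteq> univ F" for A0
    using K[OF that] by (simp add: in_K_iff)
  have sub: "A0 \<subseteq> U A0" for A0 by (auto simp: U_def generated_def)
  have U_univ: "U A0 \<subseteq> univ F" if "A0 \<subseteq> univ F" for A0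
    using that struct by (auto simp: U_def generated_def is_struct_def Mpart_def)
  have V: "Vpart (restrict_struct F (U A0)) = Vpart F \<inter> U A0" if "A0 \<subseteq> univ F" for A0
    using U_univ[OF that] by (auto simp: Vpart_def)
  have M: "Mpart (restrict_struct F (U A0)) = Mpart F" if "A0 \<subseteq> univ F" for A0
    using U_univ[OF that] by (auto simp: Mpart_def U_def)
  have Vsub: "Vpart F \<subseteq> univ F" by (auto simp: Vpart_def)
  show ?thesis
  proof
    show "is_struct L0 (Mstruct F)" using isoM by (auto simp: isomorphic_def iso_def)
    show "off_domain_trivial L0 F"
      unfolding off_domain_trivial_def
    proof (intro conjI ballI allI impI; (elim conjE)?)
      fix R xs assume *: "R \<in> rels L0" "set xs \<subseteq> univ F" "length xs = rarity L0 R" "rint F (OldR R) xs"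
      then show "set xs \<subseteq> Mpart F"
        using K_like.OldR_M[OF K[of "set xs"], of R xs] sub[of "set xs"] M[of "set xs"] by simp
    next
      fix g xs assume *: "g \<in> funs L0" "set xs \<subseteq> univ F" "length xs = farity L0 g" "\<not> set xs \<subseteq> Mpart F"
      then show "fint F (OldF g) xs = hd xs"
        using K_like.OldF_hd[OF K[of "set xs"], of g xs] sub[of "set xs"] M[of "set xs"] by simp
    next
      fix x y assume *: "x \<in> univ F" "y \<in> univ F"
      note xy = K[of "{x, y}"] sub[of "{x, y}"] V[of "{x, y}"]
      show "x \<in> Vpart F" "y \<in> Vpart F" if "tri F x y"
        using K_like.tri_V[OF xy(1), of x y] * that xy(2,3) by auto
      show "fval F x y = x" if "\<not> (x \<in> Vpart F \<and> y \<in> Vpart F \<and> x \<noteq> y)"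
        using K_like.fval_off[OF xy(1), of x y] * that xy(2,3) by auto
    qed
    have VM: "x \<in> Vpart F \<or> x \<in> Mpart F" "\<not> (x \<in> Vpart F \<and> x \<in> Mpart F)" if "x \<in> univ F" for x
      using K_like.V_Un_M[OF K[of "{x}"]] K_like.V_Int_M[OF K[of "{x}"]] sub[of "{x}"]
        V[of "{x}"] M[of "{x}"] that by auto
    show "Vpart F \<union> Mpart F = univ F" "Vpart F \<inter> Mpart F = {}"
      using VM by (auto simp: Vpart_def Mpart_def)
    show "strict_linear_order_on (Vpart F) {(x, y) \<in> Vpart F \<times> Vpart F. tri F x y}"
      unfolding strict_linear_order_on_def trans_def irrefl_def total_on_def
    proof (intro conjI allI impI ballI)
      fix x y z assume *: "(x, y) \<in> {(x, y) \<in> Vpart F \<times> Vpart F. tri F x y}"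
        "(y, z) \<in> {(x, y) \<in> Vpart F \<times> Vpart F. tri F x y}"
      then have "{x, y, z} \<subseteq> univ F" using Vsub by auto
      then show "(x, z) \<in> {(x, y) \<in> Vpart F \<times> Vpart F. tri F x y}"
        using K_like.tri_trans[OF K[of "{x, y, z}"], of x y z] * V[of "{x, y, z}"] sub[of "{x, y, z}"]
        by simp
    next
      fix x
      show "(x, x) \<notin> {(x, y) \<in> Vpart F \<times> Vpart F. tri F x y}"
        using K_like.tri_irrefl[OF K[of "{x}"], of x] V[of "{x}"] sub[of "{x}"] Vsub by auto
    next
      fix x y assume *: "x \<in> Vpart F" "y \<in> Vpart F" "x \<noteq> y"
      then have "{x, y} \<subseteq> univ F" using Vsub by auto
      then show "(x, y) \<in> {(x, y) \<in> Vpart F \<times> Vpart F. tri F x y} \<or>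
          (y, x) \<in> {(x, y) \<in> Vpart F \<times> Vpart F. tri F x y}"
        using K_like.tri_total[OF K[of "{x, y}"], of x y] * V[of "{x, y}"] sub[of "{x, y}"] by simp
    qed
    show "fval F x y = fval F y x" if "x \<in> Vpart F" "y \<in> Vpart F" "x \<noteq> y" for x y
      using K_like.fval_sym[OF K[of "{x, y}"], of x y] that V[of "{x, y}"] sub[of "{x, y}"] Vsub
      by auto
    show "fval F x y \<in> Mpart F" if "x \<in> Vpart F" "y \<in> Vpart F" "x \<noteq> y" for x y
    proof -
      have "{x, y} \<subseteq> univ F" using that Vsub by auto
      then show ?thesis
        using K_like.fval_M[OF K[of "{x, y}"], of x y] that V[of "{x, y}"] M[of "{x, y}"] sub[of "{x, y}"]
        by simp
    qed
    show "ordered_ultrametric_triple (\<lambda>u v. rint F (OldR lt) [u, v])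
          (fval F x y) (fval F x z) (fval F y z)"
      if "x \<in> Vpart F" "y \<in> Vpart F" "z \<in> Vpart F" "x \<noteq> y" "y \<noteq> z" "x \<noteq> z"
        "tri F x y" "tri F y z" for x y z
    proof -
      have "{x, y, z} \<subseteq> univ F" using that Vsub by auto
      then show ?thesis
        using K_like.triple[OF K[of "{x, y, z}"], of x y z] that V[of "{x, y, z}"] sub[of "{x, y, z}"]
        by simp
    qed
    show "x \<in> Vpart F" if "x \<in> univ F" "rint F SymN [x]" for x
      using K_like.N_V[OF K[of "{x}"], of x] that V[of "{x}"] sub[of "{x}"] by simp
  qed
qed

text \<open>Finitely generated over M therefore means: finitely many V-points together with
  M.\<close>

lemma (in K_like) fg_over_M_eq:
  assumes "A0 \<subseteq> univ A"
  shows "fg_over_M L0 A A0 = restrict_struct A ((A0 \<inter> Vpart A) \<union> Mpart A)"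
proof -
  let ?X = "(A0 \<inter> Vpart A) \<union> Mpart A"
  have "A0 \<subseteq> ?X" "?X \<subseteq> univ A" "closed_in (ext_lang L0) A ?X"
    using assms V_Un_M closed_Un_M[of "A0 \<inter> Vpart A"] by auto
  then have "generated (ext_lang L0) A A0 \<subseteq> ?X" unfolding generated_def by blast
  moreover have "A0 \<subseteq> generated (ext_lang L0) A A0" unfolding generated_def by blast
  ultimately have "generated (ext_lang L0) A A0 \<union> Mpart A = ?X" by blast
  then show ?thesis by (simp add: fg_over_M_def)
qed

text \<open>A finite extension of the image, copied into the limit, is moved back onto the domain of the
  given map by homogeneity.\<close>

lemma fraisse_limit_back:
  assumes F: "fraisse_limit L0 lt M F" and lt: "lt \<in> rels L0" "rarity L0 lt = 2"
    and M: "countable (univ M)"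
    and G: "K_like L0 lt G" and GM: "isomorphic L0 (Mstruct G) M"
    and map: "K_map L0 F G X h" and X: "finite X" and y: "y \<in> Vpart G"
  shows "\<exists>x h'. K_map L0 F G (insert x X) h' \<and> h' x = y \<and> (\<forall>z\<in>X \<union> Mpart F. h' z = h z)"
proof -
  interpret F: K_like L0 lt F by (rule fraisse_limit_K_like[OF F])
  interpret G: K_like L0 lt G by (rule G)
  note h = K_mapD[OF map]
  define Y where "Y = insert y (h ` X)"
  have Y: "finite Y" "Y \<subseteq> Vpart G" "h ` X \<subseteq> Y" using X h(2) y by (auto simp: Y_def)
  let ?C = "restrict_struct G (Y \<union> Mpart G)"
  note pC = G.parts_restrict[OF Y(2)]
  have "countable (Mpart G)"
  proof -
    obtain k where "iso L0 (Mstruct G) M k" using GM by (auto simp: isomorphic_def)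
    then have "bij_betw k (Mpart G) (univ M)" by (auto simp: iso_def)
    then show ?thesis using M by (metis bij_betw_def countable_image_inj_on)
  qed
  then have count: "countable (univ ?C)" using Y(1) by (simp add: countable_finite)
  have "Mstruct ?C = Mstruct G" by (simp add: Mstruct_def pC)
  then have "in_K L0 lt M ?C"
    unfolding in_K_iff using G.K_like_restrict[OF Y(2)] count Y(1) GM by (simp add: pC)
  \<comment> \<open>Universality of the limit is available only for members of the class on
    \<open>nat\<close>.\<close>
  moreover obtain C' where j: "iso (ext_lang L0) ?C C' (to_nat_on (univ ?C))"
    using G.is_struct_restrict[OF Y(2)] inj_on_to_nat_on[OF count] by (rule iso_transport)
  ultimately have "in_K L0 lt M C'" using lt by (blast intro: in_K_iso)
  then obtain A0 k where A0: "A0 \<subseteq> univ F" and k: "iso (ext_lang L0) C' (fg_over_M L0 F A0) k"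
    using fraisse_limitD(5)[OF F] unfolding isomorphic_def by blast
  \<comment> \<open>This copies the M-part of \<open>G\<close> and \<open>Y\<close> into the limit,
    but with no relation to the inverse of \<open>h\<close>, not even on the M-part.\<close>
  define t where "t = k \<circ> to_nat_on (univ ?C)"
  have "iso (ext_lang L0) ?C (restrict_struct F ((A0 \<inter> Vpart F) \<union> Mpart F)) t"
    using iso_comp[OF j k] unfolding F.fg_over_M_eq[OF A0] t_def .
  then have t: "K_map L0 G F Y t" by (rule iso_K_map[OF G F.K_like_axioms Y(2), rotated]) simp
  have th: "K_map L0 F F X (t \<circ> h)"
    by (rule K_map_comp[OF map K_map_mono[OF t Y(3)]])
  define Z where "Z = (t \<circ> h) ` X"
  have Z: "finite Z" "Z \<subseteq> Vpart F" using X K_mapD(2)[OF th] by (auto simp: Z_def)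
  have th_iso: "iso (ext_lang L0) (restrict_struct F (X \<union> Mpart F)) (restrict_struct F (Z \<union> Mpart F)) (t \<circ> h)"
    using K_map_iso[OF F.K_like_axioms F.K_like_axioms th] unfolding Z_def .
  \<comment> \<open>The discrepancy \<open>t \<circ> h\<close> is a partial isomorphism inside the
    limit. Its inverse extends to an automorphism \<open>g\<close>, so \<open>g \<circ> t\<close>
    undoes \<open>h\<close>.\<close>
  let ?r = "inv_into (X \<union> Mpart F) (t \<circ> h)"
  have fg: "fg_over_M L0 F W = restrict_struct F (W \<union> Mpart F)" if "W \<subseteq> Vpart F" for W
    using F.fg_over_M_eq[of W] that F.V_sub by (simp add: Int_absorb2)
  have r: "iso (ext_lang L0) (fg_over_M L0 F Z) (fg_over_M L0 F X) ?r"
    using iso_inv[OF th_iso] unfolding fg[OF Z(2)] fg[OF h(1)] by simp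
  have "finite Z" "Z \<subseteq> univ F" "X \<subseteq> univ F" using Z h(1) F.V_sub by auto
  then obtain g where g: "iso (ext_lang L0) F F g" and gr: "\<And>z. z \<in> Z \<union> Mpart F \<Longrightarrow> g z = ?r z"
    using fraisse_limitD(6)[OF F _ _ X _ r] unfolding fg[OF Z(2)] restrict_struct_simps by blast
  have "K_map L0 F F (Vpart F) g"
    using g F.V_Un_M
    by (intro iso_K_map(1)[OF F.K_like_axioms F.K_like_axioms, of _ "Vpart F"])
      (simp_all add: restrict_struct_univ)
  then have "K_map L0 F F (t ` Y) g" using K_mapD(2)[OF t] by (rule K_map_mono)
  then have gt: "K_map L0 G F Y (g \<circ> t)" by (rule K_map_comp[OF t])
  define s where "s = g \<circ> t"
  have s: "K_map L0 G F Y s" using gt unfolding s_def .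
  have sh: "s (h z) = z" if "z \<in> X \<union> Mpart F" for z
  proof -
    have "(t \<circ> h) z \<in> Z \<union> Mpart F" using isoD(5)[OF th_iso] that by auto
    then show ?thesis
      using gr[of "(t \<circ> h) z"] inv_into_f_f[OF isoD(4)[OF th_iso], of z] that by (simp add: s_def)
  qed
  \<comment> \<open>As \<open>s\<close> inverts \<open>h\<close> on
    \<open>X \<union> Mpart F\<close>, its own inverse extends \<open>h\<close> and takes this
    \<open>x\<close> to \<open>y\<close>.\<close>
  define x where "x = s y"
  have sY: "s ` Y = insert x X" using sh by (force simp: Y_def x_def)
  have s_iso: "iso (ext_lang L0) ?C (restrict_struct F (insert x X \<union> Mpart F)) s"
    using K_map_iso[OF G F.K_like_axioms s] unfolding sY .
  let ?h' = "inv_into (Y \<union> Mpart G) s"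
  have inv: "?h' (s z) = z" if "z \<in> Y \<union> Mpart G" for z
    using isoD(4)[OF s_iso] that by simp
  have "K_map L0 F G (insert x X) ?h'"
  proof (rule iso_K_map(1)[OF F.K_like_axioms G _ Y(2)])
    show "insert x X \<subseteq> Vpart F" using K_mapD(2)[OF s] sY by simp
    show "iso (ext_lang L0) (restrict_struct F (insert x X \<union> Mpart F)) ?C ?h'"
      using iso_inv[OF s_iso] by simp
  qed
  moreover have "?h' x = y" using inv[of y] by (simp add: x_def Y_def)
  moreover have "?h' z = h z" if "z \<in> X \<union> Mpart F" for z
  proof -
    have "h z \<in> Y \<union> Mpart G" using that isoD(5)[OF h(4)] Y(3) by auto
    then show ?thesis using inv[of "h z"] sh[OF that] by simp
  qed
  ultimately show ?thesis by blast
qed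

text \<open>The assumption \<open>fwd\<close> asks only for one-point extensions by elements of V;
  elements of M are always in the domain already, and the back step is supplied by the
  limit.\<close>

lemma is_model_of_forth:
  assumes F: "fraisse_limit L0 lt M F" and lt: "lt \<in> rels L0" "rarity L0 lt = 2"
    and M: "countable (univ M)"
    and G: "K_like L0 lt G" and GM: "isomorphic L0 (Mstruct G) M"
    and fwd: "\<And>X h x. finite X \<Longrightarrow> K_map L0 F G X h \<Longrightarrow> x \<in> Vpart F \<Longrightarrow> x \<notin> X \<Longrightarrow>
      \<exists>y. y \<in> Vpart G \<and> y \<notin> h ` X \<and> (rint F SymN [x] \<longleftrightarrow> rint G SymN [y]) \<and>
        (\<forall>a\<in>X. (tri F a x \<longleftrightarrow> tri G (h a) y) \<and> h (fval F a x) = fval G (h a) y)"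
    and p: "sentence (ext_lang L0) p" "is_model (ext_lang L0) F p"
  shows "is_model (ext_lang L0) G p"
proof -
  interpret F: K_like L0 lt F by (rule fraisse_limit_K_like[OF F])
  interpret G: K_like L0 lt G by (rule G)
  \<comment> \<open>Finiteness is kept for the V-part alone: homogeneity of the limit and the forth
    assumption both need it.\<close>
  let ?S = "\<lambda>X' h. \<exists>X. finite X \<and> K_map L0 F G X h \<and> X' = X \<union> Mpart F"
  have img: "h ` (X \<union> Mpart F) = h ` X \<union> Mpart G" if "K_map L0 F G X h" for X h
    using isoD(5)[OF K_mapD(4)[OF that]] by (simp add: image_Un)
  obtain h0 where h0: "iso L0 (Mstruct F) (Mstruct G) h0"
  proof -
    obtain a b where "iso L0 (Mstruct F) M a" "iso L0 (Mstruct G) M b"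
      using fraisse_limitD(3)[OF F] GM unfolding isomorphic_def by blast
    then show thesis using that iso_comp iso_inv by blast
  qed
  have "?S (Mpart F) h0"
    using h0 by (intro exI[of _ "{}"]) (simp add: K_map_def)
  then show ?thesis
  proof (rule is_model_back_and_forth[of ?S])
    fix X' h assume "?S X' h"
    then obtain X where X: "finite X" "K_map L0 F G X h" "X' = X \<union> Mpart F" by blast
    note m = K_mapD[OF X(2)]
    show "iso (ext_lang L0) (restrict_struct F X') (restrict_struct G (h ` X')) h"
      using K_map_iso[OF F.K_like_axioms G X(2)] unfolding X(3) img[OF X(2)] .
    show "X' \<subseteq> univ F \<and> h ` X' \<subseteq> univ G"
      using m(1,2) F.V_Un_M G.V_Un_M unfolding X(3) img[OF X(2)] by blast
    show "\<exists>X'' h'. ?S X'' h' \<and> X' \<subseteq> X'' \<and> x \<in> X'' \<and> (\<forall>z\<in>X'. h' z = h z)" if x: "x \<in> univ F" for x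
    proof (cases "x \<in> X'")
      case True
      then show ?thesis using X by blast
    next
      case False
      then have xV: "x \<in> Vpart F" "x \<notin> X" "x \<notin> Mpart F" using x F.V_Un_M X(3) by auto
      obtain y where y: "y \<in> Vpart G" "y \<notin> h ` X" "rint F SymN [x] \<longleftrightarrow> rint G SymN [y]"
        "\<And>a. a \<in> X \<Longrightarrow> tri F a x \<longleftrightarrow> tri G (h a) y"
        "\<And>a. a \<in> X \<Longrightarrow> h (fval F a x) = fval G (h a) y"
        using fwd[OF X(1,2) xV(1,2)] by blast
      have "K_map L0 F G (insert x X) (h(x := y))"
        using K_map_extend[OF F.K_like_axioms G X(2) xV(1,2) y] .
      then have "?S (insert x X \<union> Mpart F) (h(x := y))" using X(1) by blast
      moreover have "\<forall>z\<in>X'. (h(x := y)) z = h z" using False by auto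
      moreover have "X' \<subseteq> insert x X \<union> Mpart F" "x \<in> insert x X \<union> Mpart F" using X(3) by auto
      ultimately show ?thesis by blast
    qed
    show "\<exists>X'' h'. ?S X'' h' \<and> X' \<subseteq> X'' \<and> y \<in> h' ` X'' \<and> (\<forall>z\<in>X'. h' z = h z)" if y: "y \<in> univ G" for y
    proof (cases "y \<in> Mpart G")
      case True
      then have "y \<in> h ` X'" using img[OF X(2)] X(3) by simp
      then show ?thesis using X by blast
    next
      case False
      then have "y \<in> Vpart G" using y G.V_Un_M by auto
      then obtain x h' where "K_map L0 F G (insert x X) h'" "h' x = y" "\<forall>z\<in>X \<union> Mpart F. h' z = h z"
        using fraisse_limit_back[OF F lt M G GM X(2,1)] by blast
      moreover from this have "?S (insert x X \<union> Mpart F) h'" using X(1) by blast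
      moreover have "X' \<subseteq> insert x X \<union> Mpart F" using X(3) by auto
      moreover have "y \<in> h' ` (insert x X \<union> Mpart F)" using \<open>h' x = y\<close> by blast
      ultimately show ?thesis unfolding X(3) by blast
    qed
  qed (use p G.is_struct_ext in auto)
qed

section \<open>Finitely supported functions on a linear order\<close>

definition strict_lin_on :: "'a set \<Rightarrow> ('a \<Rightarrow> 'a \<Rightarrow> bool) \<Rightarrow> bool" where
  "strict_lin_on S R \<longleftrightarrow>
     (\<forall>x\<in>S. \<not> R x x) \<and> (\<forall>x\<in>S. \<forall>y\<in>S. \<forall>z\<in>S. R x y \<longrightarrow> R y z \<longrightarrow> R x z) \<and>
     (\<forall>x\<in>S. \<forall>y\<in>S. x \<noteq> y \<longrightarrow> R x y \<or> R y x)"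

lemma strict_lin_onD:
  assumes "strict_lin_on S R"
  shows "x \<in> S \<Longrightarrow> \<not> R x x"
    "x \<in> S \<Longrightarrow> y \<in> S \<Longrightarrow> z \<in> S \<Longrightarrow> R x y \<Longrightarrow> R y z \<Longrightarrow> R x z"
    "x \<in> S \<Longrightarrow> y \<in> S \<Longrightarrow> x \<noteq> y \<Longrightarrow> R x y \<or> R y x"
    "x \<in> S \<Longrightarrow> y \<in> S \<Longrightarrow> R x y \<Longrightarrow> \<not> R y x"
  using assms unfolding strict_lin_on_def by blast+

lemma strict_lin_on_converse: "strict_lin_on S R \<Longrightarrow> strict_lin_on S (\<lambda>x y. R y x)"
  unfolding strict_lin_on_def by blast

lemma strict_lin_on_finite_min:
  assumes "strict_lin_on S R"
  shows "finite X \<Longrightarrow> X \<noteq> {} \<Longrightarrow> X \<subseteq> S \<Longrightarrow> \<exists>m\<in>X. \<forall>x\<in>X. x \<noteq> m \<longrightarrow> R m x"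
proof (induction X rule: finite_ne_induct)
  case (insert x X)
  then obtain m where m: "m \<in> X" "\<forall>x\<in>X. x \<noteq> m \<longrightarrow> R m x" by auto
  have S: "x \<in> S" "m \<in> S" "X \<subseteq> S" "x \<noteq> m" using insert m by auto
  show ?case
  proof (cases "R x m")
    case True
    then have "R x y" if "y \<in> X" for y
      using m that S strict_lin_onD(2)[OF assms, of x m y] by (cases "y = m") auto
    then show ?thesis by blast
  next
    case False
    then have "R m x" using strict_lin_onD(3)[OF assms S(1,2,4)] by blast
    then show ?thesis using m by blast
  qed
qed simp

text \<open>Since \<open>P\<close> and \<open>R\<close> may be empty, \<open>dense\<close> includes
  the absence of endpoints and the existence of values of both colours. The default value
  \<open>z\<close> is uncoloured, so a finitely supported function has finitely many coloured
  values.\<close>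

locale colored_lin =
  fixes U :: "'m set" and ltM :: "'m \<Rightarrow> 'm \<Rightarrow> bool"
    and Q :: "'q set" and ltQ :: "'q \<Rightarrow> 'q \<Rightarrow> bool" and col :: "'q \<Rightarrow> bool" and z :: 'q
  assumes linM: "strict_lin_on U ltM" and U_nonempty: "U \<noteq> {}"
    and linQ: "strict_lin_on Q ltQ" and z: "z \<in> Q" "\<not> col z"
    and dense: "\<And>P R c. finite P \<Longrightarrow> finite R \<Longrightarrow> P \<subseteq> Q \<Longrightarrow> R \<subseteq> Q \<Longrightarrow>
      (\<And>p r. p \<in> P \<Longrightarrow> r \<in> R \<Longrightarrow> ltQ p r) \<Longrightarrow>
      \<exists>q\<in>Q. (col q \<longleftrightarrow> c) \<and> (\<forall>p\<in>P. ltQ p q) \<and> (\<forall>r\<in>R. ltQ q r)"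
begin

text \<open>The value \<open>z\<close> off \<open>U\<close> makes these total functions correspond
  to functions on \<open>U\<close>, so that distinct ones differ inside \<open>U\<close>.\<close>

definition seqs :: "('m \<Rightarrow> 'q) set" where
  "seqs = {s. (\<forall>m. s m \<in> Q) \<and> (\<forall>m. m \<notin> U \<longrightarrow> s m = z) \<and> finite {m. s m \<noteq> z}}"

definition first_diff :: "('m \<Rightarrow> 'q) \<Rightarrow> ('m \<Rightarrow> 'q) \<Rightarrow> 'm" where
  "first_diff s t = (THE m. m \<in> U \<and> s m \<noteq> t m \<and> (\<forall>k\<in>U. ltM k m \<longrightarrow> s k = t k))"

definition lex_less :: "('m \<Rightarrow> 'q) \<Rightarrow> ('m \<Rightarrow> 'q) \<Rightarrow> bool" where
  "lex_less s t \<longleftrightarrow> s \<noteq> t \<and> ltQ (s (first_diff s t)) (t (first_diff s t))"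

text \<open>Replacing one default value by \<open>q\<close> flips this exactly when \<open>q\<close>
  is coloured, whatever the other values are.\<close>

definition parity :: "('m \<Rightarrow> 'q) \<Rightarrow> bool" where
  "parity s \<longleftrightarrow> odd (card {m. col (s m)})"

lemma seqsD: "s \<in> seqs \<Longrightarrow> s m \<in> Q" "s \<in> seqs \<Longrightarrow> m \<notin> U \<Longrightarrow> s m = z"
  "s \<in> seqs \<Longrightarrow> finite {m. s m \<noteq> z}"
  unfolding seqs_def by auto

lemma const_in_seqs: "(\<lambda>_. z) \<in> seqs"
  using z by (simp add: seqs_def)

lemma upd_in_seqs:
  assumes "s \<in> seqs" "m \<in> U" "q \<in> Q"
  shows "s(m := q) \<in> seqs"
proof -
  have "{k. (s(m := q)) k \<noteq> z} \<subseteq> insert m {k. s k \<noteq> z}" by auto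
  then have "finite {k. (s(m := q)) k \<noteq> z}" using seqsD(3)[OF assms(1)] finite_subset by blast
  then show ?thesis using assms by (auto simp: seqs_def)
qed

lemma first_diff_eqI:
  assumes "m \<in> U" "s m \<noteq> t m" "\<And>k. k \<in> U \<Longrightarrow> ltM k m \<Longrightarrow> s k = t k"
  shows "first_diff s t = m"
  unfolding first_diff_def
  by (rule the_equality) (use assms strict_lin_onD(3)[OF linM] in blast)+

text \<open>Two finitely supported functions differ at finitely many arguments only, and a finite
  set has a least element even in a dense order.\<close>

lemma first_diff:
  assumes "s \<in> seqs" "t \<in> seqs" "s \<noteq> t"
  shows "first_diff s t \<in> U" "s (first_diff s t) \<noteq> t (first_diff s t)"
    "\<And>k. k \<in> U \<Longrightarrow> ltM k (first_diff s t) \<Longrightarrow> s k = t k"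
proof -
  let ?D = "{m. s m \<noteq> t m}"
  have "?D \<subseteq> {m. s m \<noteq> z} \<union> {m. t m \<noteq> z}" by auto
  then have "finite ?D" using seqsD(3) assms finite_subset by blast
  moreover have "?D \<noteq> {}" using assms(3) by auto
  moreover have "?D \<subseteq> U" using assms seqsD(2)[of s] seqsD(2)[of t] by auto
  ultimately obtain m where m: "m \<in> ?D" "\<forall>x\<in>?D. x \<noteq> m \<longrightarrow> ltM m x"
    using strict_lin_on_finite_min[OF linM, of ?D] by blast
  have "m \<in> U" using m \<open>?D \<subseteq> U\<close> by blast
  have below: "s k = t k" if "k \<in> U" "ltM k m" for k
    using that m(2) strict_lin_onD(1)[OF linM that(1)] strict_lin_onD(4)[OF linM that(1) \<open>m \<in> U\<close>]
    by (cases "k = m") auto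
  have "first_diff s t = m" using m \<open>m \<in> U\<close> below by (intro first_diff_eqI) auto
  then show "first_diff s t \<in> U" "s (first_diff s t) \<noteq> t (first_diff s t)"
    "\<And>k. k \<in> U \<Longrightarrow> ltM k (first_diff s t) \<Longrightarrow> s k = t k"
    using m \<open>m \<in> U\<close> below by auto
qed

lemma first_diff_sym: "first_diff s t = first_diff t s"
  unfolding first_diff_def by (rule arg_cong[where f = The]) auto

lemma lex_irrefl: "\<not> lex_less s s"
  by (simp add: lex_less_def)

lemma lex_total:
  assumes "s \<in> seqs" "t \<in> seqs" "s \<noteq> t"
  shows "lex_less s t \<or> lex_less t s"
  using strict_lin_onD(3)[OF linQ seqsD(1)[OF assms(1)] seqsD(1)[OF assms(2)] first_diff(2)[OF assms]]
    assms(3) first_diff_sym[of s t]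
  unfolding lex_less_def by auto

text \<open>The earlier of the two first differences is also the first difference of
  \<open>s\<close> and \<open>u\<close>. This one comparison yields both transitivity and the
  condition on triples.\<close>

lemma lex_trans_triple:
  assumes s: "s \<in> seqs" and t: "t \<in> seqs" and u: "u \<in> seqs" and st: "lex_less s t" and tu: "lex_less t u"
  shows "lex_less s u \<and>
    ordered_ultrametric_triple ltM (first_diff s t) (first_diff s u) (first_diff t u)"
proof -
  let ?a = "first_diff s t" and ?b = "first_diff t u"
  have ne: "s \<noteq> t" "t \<noteq> u" using st tu by (auto simp: lex_less_def)
  have lt: "ltQ (s ?a) (t ?a)" "ltQ (t ?b) (u ?b)" using st tu by (auto simp: lex_less_def)
  note a = first_diff[OF s t ne(1)] and b = first_diff[OF t u ne(2)]
  note trM = strict_lin_onD(2)[OF linM]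
  consider "ltM ?a ?b" | "ltM ?b ?a" | "?a = ?b" using strict_lin_onD(3)[OF linM a(1) b(1)] by blast
  then show ?thesis
  proof cases
    case 1
    have ta: "t ?a = u ?a" using b(3)[OF a(1) 1] .
    then have "first_diff s u = ?a"
      using a b trM[OF _ a(1) b(1) _ 1] by (intro first_diff_eqI) auto
    then show ?thesis
      using lt(1) ta a(2) 1 by (auto simp: lex_less_def ordered_ultrametric_triple_def)
  next
    case 2
    have tb: "s ?b = t ?b" using a(3)[OF b(1) 2] .
    then have "first_diff s u = ?b"
      using a b trM[OF _ b(1) a(1) _ 2] by (intro first_diff_eqI) auto
    then show ?thesis
      using lt(2) tb b(2) 2 by (auto simp: lex_less_def ordered_ultrametric_triple_def)
  next
    case 3
    \<comment> \<open>With both differences at one level the values there increase twice, so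
      \<open>s\<close> and \<open>u\<close> cannot agree again.\<close>
    have lt': "ltQ (s ?a) (u ?a)"
      using lt 3 strict_lin_onD(2)[OF linQ seqsD(1)[OF s] seqsD(1)[OF t] seqsD(1)[OF u]] by metis
    then have ne': "s ?a \<noteq> u ?a" using strict_lin_onD(1)[OF linQ seqsD(1)[OF u]] by metis
    then have "first_diff s u = ?a"
      using a b 3 by (intro first_diff_eqI) auto
    then show ?thesis
      using lt' ne' 3 by (auto simp: lex_less_def ordered_ultrametric_triple_def)
  qed
qed

section \<open>Prescribing the colour and the one-point type\<close>

lemma parity_upd:
  assumes "s \<in> seqs" "s m = z"
  shows "parity (s(m := q)) \<longleftrightarrow> parity s \<noteq> col q"
proof -
  let ?C = "{k. col (s k)}"
  have "?C \<subseteq> {k. s k \<noteq> z}" using z(2) by auto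
  then have fin: "finite ?C" using seqsD(3)[OF assms(1)] finite_subset by blast
  have "m \<notin> ?C" using assms(2) z(2) by simp
  moreover have "{k. col ((s(m := q)) k)} = (if col q then insert m ?C else ?C)"
    using assms(2) z(2) by auto
  ultimately show ?thesis using fin by (auto simp: parity_def)
qed

text \<open>The new point branches off at the largest prescribed level, choosing there a value in the
  prescribed cut; the colour of this value corrects the parity.\<close>

lemma realize_type:
  fixes b :: "'i \<Rightarrow> 'm \<Rightarrow> 'q" and d :: "'i \<Rightarrow> 'm" and lo :: "'i \<Rightarrow> bool"
  assumes X: "finite X" and b: "\<And>x. x \<in> X \<Longrightarrow> b x \<in> seqs" and inj: "inj_on b X"
    and d: "\<And>x. x \<in> X \<Longrightarrow> d x \<in> U"
    and c1: "\<And>x x'. x \<in> X \<Longrightarrow> x' \<in> X \<Longrightarrow> lex_less (b x) (b x') \<Longrightarrow> lo x' \<Longrightarrow>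
      lo x \<and> ordered_ultrametric_triple ltM (first_diff (b x) (b x')) (d x) (d x')"
    and c2: "\<And>x x'. x \<in> X \<Longrightarrow> x' \<in> X \<Longrightarrow> lex_less (b x) (b x') \<Longrightarrow> \<not> lo x \<Longrightarrow>
      \<not> lo x' \<and> ordered_ultrametric_triple ltM (d x) (d x') (first_diff (b x) (b x'))"
    and c3: "\<And>x x'. x \<in> X \<Longrightarrow> x' \<in> X \<Longrightarrow> lex_less (b x) (b x') \<Longrightarrow> lo x \<Longrightarrow> \<not> lo x' \<Longrightarrow>
      ordered_ultrametric_triple ltM (d x) (first_diff (b x) (b x')) (d x')"
  shows "\<exists>y\<in>seqs. (parity y \<longleftrightarrow> c) \<and>
    (\<forall>x\<in>X. b x \<noteq> y \<and> first_diff (b x) y = d x \<and> (lex_less (b x) y \<longleftrightarrow> lo x))"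
proof (cases "X = {}")
  case True
  obtain m where m: "m \<in> U" using U_nonempty by blast
  \<comment> \<open>Only the colour is prescribed here, so one suitable value at any argument
    suffices.\<close>
  obtain q where q: "q \<in> Q" "col q \<longleftrightarrow> (parity (\<lambda>_. z) \<noteq> c)" using dense[of "{}" "{}"] by auto
  have "parity ((\<lambda>_. z)(m := q)) \<longleftrightarrow> c" using parity_upd[OF const_in_seqs, of m q] q by auto
  then show ?thesis using True upd_in_seqs[OF const_in_seqs m q(1)] by blast
next
  case False
  note irM = strict_lin_onD(1)[OF linM] and trM = strict_lin_onD(2)[OF linM]
    and toM = strict_lin_onD(3)[OF linM] and asM = strict_lin_onD(4)[OF linM]
  \<comment> \<open>The largest level is found as a minimum of the converse order. A point
    \<open>x0\<close> attaining it is the one that the new function follows longest.\<close>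
  obtain m where m: "m \<in> d ` X" "\<forall>k\<in>d ` X. k \<noteq> m \<longrightarrow> ltM k m"
    using strict_lin_on_finite_min[OF strict_lin_on_converse[OF linM], of "d ` X"] X False d by blast
  then obtain x0 where x0: "x0 \<in> X" "d x0 = m" by blast
  have mU: "m \<in> U" using x0 d by blast
  have max: "\<not> ltM m (d x)" if "x \<in> X" for x
    using that m(2) asM[OF mU d[OF that]] irM[OF mU] by (cases "d x = m") auto
  have b_ne: "b x \<noteq> b x'" if "x \<in> X" "x' \<in> X" "x \<noteq> x'" for x x'
    using that inj by (auto simp: inj_on_def)
  have fd: "first_diff (b x) (b x') \<in> U" if "x \<in> X" "x' \<in> X" "x \<noteq> x'" for x x'
    using first_diff(1)[OF b b b_ne, OF that(1,2) that] .
  \<comment> \<open>These points agree with \<open>b x0\<close> everywhere below \<open>m\<close>,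
    so only they constrain the value at \<open>m\<close>.\<close>
  define C where "C = {x \<in> X. x = x0 \<or> \<not> ltM (first_diff (b x) (b x0)) m}"
  have total: "lex_less (b x) (b x') \<or> lex_less (b x') (b x)" if "x \<in> X" "x' \<in> X" "x \<noteq> x'" for x x'
    using lex_total[OF b b b_ne, OF that(1,2) that] .
  have asym: "\<not> lex_less (b x') (b x)" if "x \<in> X" "x' \<in> X" "lex_less (b x) (b x')" for x x'
    using lex_trans_triple[of "b x" "b x'" "b x"] lex_irrefl that b by blast
  \<comment> \<open>In a triple the smallest level occurs at least twice. As \<open>x\<close> leaves
    \<open>x0\<close> below \<open>d x0 = m\<close>, its level towards the new point must be the
    same early one, and the new point lies on the same side of \<open>x\<close> as
    \<open>x0\<close>.\<close>
  have far: "d x = first_diff (b x) (b x0) \<and> (lo x \<longleftrightarrow> lex_less (b x) (b x0))"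
    if x: "x \<in> X" "x \<notin> C" for x
  proof -
    have ne: "x \<noteq> x0" and lt: "ltM (first_diff (b x) (b x0)) m" using x by (auto simp: C_def)
    have U: "first_diff (b x) (b x0) \<in> U" "d x \<in> U" using fd d x x0 ne by auto
    have F: "first_diff (b x) (b x0) \<noteq> m" "\<not> ltM m (first_diff (b x) (b x0))"
      using lt irM[OF mU] asM[OF U(1) mU] by auto
    note sym = first_diff_sym[of "b x0" "b x"]
    from total[OF x(1) x0(1) ne] show ?thesis
    proof
      assume l: "lex_less (b x) (b x0)"
      show ?thesis
        using c1[OF x(1) x0(1) l] c2[OF x(1) x0(1) l] c3[OF x(1) x0(1) l] F l lt x0(2) max[OF x(1)]
        unfolding ordered_ultrametric_triple_def by (cases "lo x"; cases "lo x0") auto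
    next
      assume l: "lex_less (b x0) (b x)"
      show ?thesis
        using c1[OF x0(1) x(1) l] c2[OF x0(1) x(1) l] c3[OF x0(1) x(1) l] F l lt x0(2) max[OF x(1)]
          asym[OF x0(1) x(1) l] sym
        unfolding ordered_ultrametric_triple_def by (cases "lo x"; cases "lo x0") auto
    qed
  qed
  \<comment> \<open>A level below \<open>m\<close> would be the strictly smallest of its triple; a
    level above \<open>m\<close> is excluded by maximality.\<close>
  have near: "d x = m" if x: "x \<in> C" for x
  proof (cases "x = x0")
    case False
    have xX: "x \<in> X" and F: "\<not> ltM (first_diff (b x) (b x0)) m" using x False by (auto simp: C_def)
    note sym = first_diff_sym[of "b x0" "b x"]
    from total[OF xX x0(1) False] show ?thesis
    proof
      assume l: "lex_less (b x) (b x0)"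
      show ?thesis
        using c1[OF xX x0(1) l] c2[OF xX x0(1) l] c3[OF xX x0(1) l] F x0(2) max[OF xX]
        unfolding ordered_ultrametric_triple_def by (cases "lo x"; cases "lo x0") auto
    next
      assume l: "lex_less (b x0) (b x)"
      show ?thesis
        using c1[OF x0(1) xX l] c2[OF x0(1) xX l] c3[OF x0(1) xX l] F x0(2) max[OF xX] sym
        unfolding ordered_ultrametric_triple_def by (cases "lo x"; cases "lo x0") auto
    qed
  qed (use x0 in simp)
  \<comment> \<open>The new point lies between \<open>x\<close> and \<open>x'\<close> at level
    \<open>m\<close> from both; the minimum rule makes \<open>m\<close> their own first
    difference.\<close>
  have cut: "ltQ (b x m) (b x' m)" if x: "x \<in> C" "lo x" and x': "x' \<in> C" "\<not> lo x'" for x x'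
  proof -
    have X': "x \<in> X" "x' \<in> X" "x \<noteq> x'" using x x' by (auto simp: C_def)
    have l: "lex_less (b x) (b x')" using total[OF X'] c2[OF X'(2,1)] x x' by blast
    have "first_diff (b x) (b x') = m"
      using c3[OF X'(1,2) l x(2) x'(2)] near[OF x(1)] near[OF x'(1)] irM[OF mU]
      unfolding ordered_ultrametric_triple_def by auto
    then show ?thesis using l by (auto simp: lex_less_def)
  qed
  \<comment> \<open>Cutting off at \<open>m\<close> puts the default value at \<open>m\<close>
    itself, as \<open>parity_upd\<close> requires.\<close>
  define s where "s = (\<lambda>k. if k \<in> U \<and> ltM k m then b x0 k else z)"
  have "{k. s k \<noteq> z} \<subseteq> {k. b x0 k \<noteq> z}" by (auto simp: s_def)
  then have "finite {k. s k \<noteq> z}" using seqsD(3)[OF b[OF x0(1)]] finite_subset by blast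
  then have s: "s \<in> seqs" using seqsD(1)[OF b[OF x0(1)]] z(1) by (auto simp: seqs_def s_def)
  have sm: "s m = z" using irM[OF mU] by (simp add: s_def)
  let ?P = "(\<lambda>x. b x m) ` {x \<in> C. lo x}" and ?R = "(\<lambda>x. b x m) ` {x \<in> C. \<not> lo x}"
  have "\<exists>q\<in>Q. (col q \<longleftrightarrow> (parity s \<noteq> c)) \<and> (\<forall>p\<in>?P. ltQ p q) \<and> (\<forall>r\<in>?R. ltQ q r)"
  proof (rule dense)
    show "finite ?P" "finite ?R" using X by (auto simp: C_def)
    show "?P \<subseteq> Q" "?R \<subseteq> Q" using seqsD(1) b by (auto simp: C_def)
  qed (use cut in auto)
  then obtain q where q: "q \<in> Q" "col q \<longleftrightarrow> (parity s \<noteq> c)"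
    "\<And>x. x \<in> C \<Longrightarrow> lo x \<Longrightarrow> ltQ (b x m) q" "\<And>x. x \<in> C \<Longrightarrow> \<not> lo x \<Longrightarrow> ltQ q (b x m)" by auto
  define y where "y = s(m := q)"
  have y: "y \<in> seqs" unfolding y_def by (rule upd_in_seqs[OF s mU q(1)])
  have ym: "y m = q" by (simp add: y_def)
  have below: "y k = b x0 k" if "k \<in> U" "ltM k m" for k
    using that irM[OF mU] by (auto simp: y_def s_def)
  have par: "parity y \<longleftrightarrow> c" unfolding y_def using parity_upd[OF s sm] q(2) by auto
  have "b x \<noteq> y \<and> first_diff (b x) y = d x \<and> (lex_less (b x) y \<longleftrightarrow> lo x)" if x: "x \<in> X" for x
  proof (cases "x \<in> C")
    case True
    have bq: "b x m \<in> Q" using seqsD(1)[OF b[OF x]] .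
    \<comment> \<open>Every point of \<open>C\<close> is on one side of the cut, so \<open>q\<close>
      is strictly above or strictly below its value.\<close>
    have ne: "b x m \<noteq> q" using q(3,4)[OF True] strict_lin_onD(1)[OF linQ q(1)] by metis
    have agree: "b x k = b x0 k" if k: "k \<in> U" "ltM k m" for k
    proof (cases "x = x0")
      case False
      then have "\<not> ltM (first_diff (b x) (b x0)) m" using True by (auto simp: C_def)
      then have "ltM k (first_diff (b x) (b x0))"
        using toM[OF fd[OF x x0(1) False] mU] trM[OF k(1) mU fd[OF x x0(1) False] k(2)] k(2) by metis
      moreover have "b x \<noteq> b x0" using b_ne[OF x x0(1) False] .
      ultimately show ?thesis using first_diff(3)[OF b[OF x] b[OF x0(1)]] k by blast
    qed simp
    have "first_diff (b x) y = m"
      using mU ne agree below ym by (intro first_diff_eqI) auto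
    moreover have "ltQ (b x m) q \<longleftrightarrow> lo x"
      using q(3,4)[OF True] strict_lin_onD(4)[OF linQ bq q(1)] by blast
    ultimately show ?thesis using ne ym near[OF True] by (auto simp: lex_less_def)
  next
    case False
    \<comment> \<open>At this level \<open>y\<close> still follows \<open>b x0\<close>, so
      \<open>b x\<close> stands to \<open>y\<close> as it stands to \<open>b x0\<close>;
      \<open>far\<close> says that this is what was prescribed.\<close>
    let ?e = "first_diff (b x) (b x0)"
    have ne: "x \<noteq> x0" and lt: "ltM ?e m" using x False by (auto simp: C_def)
    have bne: "b x \<noteq> b x0" using b_ne[OF x x0(1) ne] .
    note e = first_diff[OF b[OF x] b[OF x0(1)] bne]
    have ye: "y ?e = b x0 ?e" using below[OF e(1) lt] .
    have "first_diff (b x) y = ?e"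
    proof (rule first_diff_eqI[OF e(1)])
      show "b x k = y k" if "k \<in> U" "ltM k ?e" for k
        using e(3)[OF that] below[OF that(1) trM[OF that(1) e(1) mU that(2) lt]] by simp
    qed (use e(2) ye in simp)
    then show ?thesis using far[OF x False] ye e(2) bne by (auto simp: lex_less_def)
  qed
  then show ?thesis using y par by blast
qed

end

section \<open>The tree structure\<close>

locale tree_struct =
  colored_lin "univ M" "\<lambda>u v. rint M lt [u, v]" Q ltQ col z
  for L0 :: "('f, 'r) lang" and lt :: 'r and M :: "('f, 'r, 'm) struct"
    and Q :: "'q set" and ltQ col z +
  assumes struct_M: "is_struct L0 M" and lt: "lt \<in> rels L0" "rarity L0 lt = 2"
begin

text \<open>Left summands form V, right summands form the copy of \<open>M\<close>. The tests
  against \<open>range Inr\<close> agree with membership in the M-part on tuples over the universe,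
  and \<open>hd xs\<close> is the convention off the intended domain.\<close>

definition tree :: "('f, 'r, ('m \<Rightarrow> 'q) + 'm) xstruct" where
  "tree = \<lparr>univ = Inl ` seqs \<union> Inr ` univ M,
     fint = (\<lambda>g xs. case g of
         OldF g0 \<Rightarrow> if set xs \<subseteq> range Inr then Inr (fint M g0 (map projr xs)) else hd xs
       | SymF \<Rightarrow> (case xs of [Inl s, Inl t] \<Rightarrow> if s = t then Inl s else Inr (first_diff s t)
                  | _ \<Rightarrow> hd xs)),
     rint = (\<lambda>R xs. case R of
         OldR R0 \<Rightarrow> set xs \<subseteq> range Inr \<and> rint M R0 (map projr xs)
       | SymV \<Rightarrow> hd xs \<in> range Inl
       | SymM \<Rightarrow> hd xs \<in> range Inr
       | SymN \<Rightarrow> (\<exists>s. hd xs = Inl s \<and> parity s)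
       | SymTri \<Rightarrow> (\<exists>s t. xs = [Inl s, Inl t] \<and> lex_less s t))\<rparr>"

lemma univ_tree: "univ tree = Inl ` seqs \<union> Inr ` univ M"
  and V_tree: "Vpart tree = Inl ` seqs" and M_tree: "Mpart tree = Inr ` univ M"
  by (auto simp: tree_def Vpart_def Mpart_def)

lemma tree_simps:
  "fint tree (OldF g) xs = (if set xs \<subseteq> range Inr then Inr (fint M g (map projr xs)) else hd xs)"
  "rint tree (OldR R) xs \<longleftrightarrow> set xs \<subseteq> range Inr \<and> rint M R (map projr xs)"
  "rint tree SymN [Inl s] \<longleftrightarrow> parity s" "\<not> rint tree SymN [Inr m]"
  "tri tree (Inl s) (Inl t) \<longleftrightarrow> lex_less s t"
  "\<not> tri tree u (Inr m)" "\<not> tri tree (Inr m) u"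
  "fval tree (Inl s) (Inl t) = (if s = t then Inl s else Inr (first_diff s t))"
  "fval tree u (Inr m) = u" "fval tree (Inr m) u = Inr m"
  by (auto simp: tree_def split: sum.splits)

lemma iso_M_tree: "iso L0 M (Mstruct tree) Inr"
proof -
  have "set xs \<subseteq> Inr ` univ M \<Longrightarrow> \<exists>ys. xs = map Inr ys \<and> set ys \<subseteq> univ M" for xs :: "(('m \<Rightarrow> 'q) + 'm) list"
    by (blast elim: set_subset_imageE)
  then have "is_struct L0 (Mstruct tree)"
    using struct_M fint_in_univ[OF struct_M]
    by (fastforce simp: is_struct_def closed_in_def M_tree tree_simps comp_def)
  then show ?thesis
    using struct_M by (auto simp: iso_def M_tree tree_simps comp_def bij_betw_def inj_on_def)
qed

lemma K_like_tree: "K_like L0 lt tree"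
proof
  show "is_struct L0 (Mstruct tree)" using isoD(2)[OF iso_M_tree] .
  have iff: "set xs \<subseteq> Mpart tree \<longleftrightarrow> set xs \<subseteq> range Inr" if "set xs \<subseteq> univ tree" for xs
    using that unfolding univ_tree M_tree by auto
  show "off_domain_trivial L0 tree"
    unfolding off_domain_trivial_def
  proof (intro conjI ballI allI impI; (elim conjE)?)
    fix R xs assume "set xs \<subseteq> univ tree" "rint tree (OldR R) xs"
    then show "set xs \<subseteq> Mpart tree" using iff by (simp add: tree_simps)
  next
    fix g xs assume "set xs \<subseteq> univ tree" "\<not> set xs \<subseteq> Mpart tree"
    then show "fint tree (OldF g) xs = hd xs" using iff by (simp add: tree_simps)
  next
    fix u v assume uv: "u \<in> univ tree" "v \<in> univ tree"
    show "u \<in> Vpart tree" "v \<in> Vpart tree" if "tri tree u v"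
      using uv that by (auto simp: univ_tree V_tree tree_simps)
    show "fval tree u v = u" if "\<not> (u \<in> Vpart tree \<and> v \<in> Vpart tree \<and> u \<noteq> v)"
      using uv that by (auto simp: univ_tree V_tree tree_simps)
  qed
  show "strict_linear_order_on (Vpart tree) {(x, y) \<in> Vpart tree \<times> Vpart tree. tri tree x y}"
    unfolding strict_linear_order_on_def trans_def irrefl_def total_on_def V_tree
  proof (intro conjI allI impI ballI)
    show "(x, w) \<in> {(x, y) \<in> Inl ` seqs \<times> Inl ` seqs. tri tree x y}"
      if "(x, y) \<in> {(x, y) \<in> Inl ` seqs \<times> Inl ` seqs. tri tree x y}"
        "(y, w) \<in> {(x, y) \<in> Inl ` seqs \<times> Inl ` seqs. tri tree x y}" for x y w
      using that by (auto simp: tree_simps dest: lex_trans_triple)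
    show "(x, y) \<in> {(x, y) \<in> Inl ` seqs \<times> Inl ` seqs. tri tree x y} \<or>
        (y, x) \<in> {(x, y) \<in> Inl ` seqs \<times> Inl ` seqs. tri tree x y}"
      if "x \<in> Inl ` seqs" "y \<in> Inl ` seqs" "x \<noteq> y" for x y
      using that lex_total by (fastforce simp: tree_simps)
  qed (auto simp: tree_simps lex_irrefl)
  show "ordered_ultrametric_triple (\<lambda>u v. rint tree (OldR lt) [u, v])
        (fval tree x y) (fval tree x w) (fval tree y w)"
    if "x \<in> Vpart tree" "y \<in> Vpart tree" "w \<in> Vpart tree" "x \<noteq> y" "y \<noteq> w" "x \<noteq> w"
      "tri tree x y" "tri tree y w" for x y w
  proof -
    obtain s t u where stu: "x = Inl s" "y = Inl t" "w = Inl u" "s \<in> seqs" "t \<in> seqs" "u \<in> seqs"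
      using \<open>x \<in> Vpart tree\<close> \<open>y \<in> Vpart tree\<close> \<open>w \<in> Vpart tree\<close> by (auto simp: V_tree)
    then have "lex_less s t" "lex_less t u" "s \<noteq> t" "t \<noteq> u" "s \<noteq> u"
      using that by (auto simp: tree_simps)
    then show ?thesis
      using lex_trans_triple[of s t u] stu by (simp add: ordered_ultrametric_triple_def tree_simps)
  qed
  show "fval tree x y = fval tree y x" if "x \<in> Vpart tree" "y \<in> Vpart tree" "x \<noteq> y" for x y
    using that first_diff_sym by (auto simp: V_tree tree_simps split: if_splits)
  show "fval tree x y \<in> Mpart tree" if "x \<in> Vpart tree" "y \<in> Vpart tree" "x \<noteq> y" for x y
    using that first_diff(1) by (auto simp: V_tree M_tree tree_simps)
  show "x \<in> Vpart tree" if "x \<in> univ tree" "rint tree SymN [x]" for x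
    using that by (auto simp: univ_tree V_tree tree_simps)
qed (auto simp: univ_tree V_tree M_tree)

text \<open>The one-point type of \<open>x\<close> over \<open>X\<close> consists of the levels
  \<open>f a x\<close>, moved to \<open>M\<close> by \<open>h\<close>, the sides
  \<open>tri F a x\<close> and the colour; \<open>realize_type\<close> produces a function with
  these data.\<close>

lemma tree_forth:
  assumes F: "K_like L0 lt F" and X: "finite X" and map: "K_map L0 F tree X h"
    and x: "x \<in> Vpart F" "x \<notin> X"
  shows "\<exists>y. y \<in> Vpart tree \<and> y \<notin> h ` X \<and> (rint F SymN [x] \<longleftrightarrow> rint tree SymN [y]) \<and>
    (\<forall>a\<in>X. (tri F a x \<longleftrightarrow> tri tree (h a) y) \<and> h (fval F a x) = fval tree (h a) y)"
proof -
  interpret F: K_like L0 lt F by fact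
  note h = K_mapD[OF map]
  define b where "b a = projl (h a)" for a
  define r where "r m = projr (h m)" for m
  have b: "h a = Inl (b a)" "b a \<in> seqs" if "a \<in> X" for a
    using h(2) that by (auto simp: b_def V_tree)
  have r: "h m = Inr (r m)" "r m \<in> univ M" if "m \<in> Mpart F" for m
  proof -
    have "h m \<in> Inr ` univ M" using isoD(5)[OF h(4)] that by (auto simp: M_tree)
    then show "h m = Inr (r m)" "r m \<in> univ M" by (auto simp: r_def)
  qed
  have r_lt: "rint F (OldR lt) [u, v] \<longleftrightarrow> rint M lt [r u, r v]" if "u \<in> Mpart F" "v \<in> Mpart F" for u v
    using isoD(7)[OF h(4), of lt "[u, v]"] that lt by (simp add: r tree_simps)
  have triple: "ordered_ultrametric_triple (\<lambda>u v. rint M lt [u, v]) (r u) (r v) (r w)"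
    if "ordered_ultrametric_triple (\<lambda>u v. rint F (OldR lt) [u, v]) u v w"
      "u \<in> Mpart F" "v \<in> Mpart F" "w \<in> Mpart F" for u v w
    using that r_lt unfolding ordered_ultrametric_triple_def by auto
  have inj: "inj_on b X" using h(3) b(1) by (auto simp: inj_on_def)
  have XV: "a \<in> Vpart F" "a \<noteq> x" if "a \<in> X" for a using that h(1) x by auto
  have lex: "a \<noteq> a' \<and> tri F a a' \<and> first_diff (b a) (b a') = r (fval F a a')"
    if "a \<in> X" "a' \<in> X" "lex_less (b a) (b a')" for a a'
  proof -
    have ne: "a \<noteq> a'" "b a \<noteq> b a'" using that by (auto simp: lex_less_def)
    have "fval F a a' \<in> Mpart F" using F.fval_M XV that ne by blast
    then have "Inr (first_diff (b a) (b a')) = (Inr (r (fval F a a')) :: ('m \<Rightarrow> 'q) + 'm)"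
      using h(7)[OF that(1,2) ne(1)] b(1) that ne r(1) by (simp add: tree_simps)
    then show ?thesis using ne h(6)[OF that(1,2) ne(1)] b(1) that by (simp add: tree_simps)
  qed
  let ?d = "\<lambda>a. r (fval F a x)" and ?lo = "\<lambda>a. tri F a x"
  have fM: "fval F a x \<in> Mpart F" if "a \<in> X" for a using F.fval_M XV[OF that] x by blast
  have fM': "fval F a a' \<in> Mpart F" if "a \<in> X" "a' \<in> X" "a \<noteq> a'" for a a'
    using F.fval_M XV that by blast
  have above: "tri F x a" if "a \<in> X" "\<not> tri F a x" for a
    using F.tri_total[of a x] XV[OF that(1)] x that(2) by blast
  have "\<exists>y\<in>seqs. (parity y \<longleftrightarrow> rint F SymN [x]) \<and>
    (\<forall>a\<in>X. b a \<noteq> y \<and> first_diff (b a) y = ?d a \<and> (lex_less (b a) y \<longleftrightarrow> ?lo a))"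
  proof (rule realize_type[OF X b(2) inj])
    show "?d a \<in> univ M" if "a \<in> X" for a using r(2)[OF fM[OF that]] .
    \<comment> \<open>The three conditions are the rule for triples in \<open>F\<close>, with
      \<open>x\<close> to the right of \<open>a\<close> and \<open>a'\<close>, to their left, and
      between them.\<close>
    fix a a' assume a: "a \<in> X" "a' \<in> X" and l: "lex_less (b a) (b a')"
    note la = lex[OF a l]
    note V = XV[OF a(1)] XV[OF a(2)]
    have xa: "fval F x a = fval F a x" "fval F x a' = fval F a' x" using F.fval_sym V x by auto
    show "?lo a \<and> ordered_ultrametric_triple (\<lambda>u v. rint M lt [u, v]) (first_diff (b a) (b a')) (?d a) (?d a')"
      if "?lo a'"
      using F.tri_trans[of a a' x] F.triple[of a a' x] V x la that
        triple[OF _ fM'[OF a] fM[OF a(1)] fM[OF a(2)]] by auto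
    show "\<not> ?lo a' \<and> ordered_ultrametric_triple (\<lambda>u v. rint M lt [u, v]) (?d a) (?d a') (first_diff (b a) (b a'))"
      if "\<not> ?lo a"
      using F.tri_trans[of a a' x] F.triple[of x a a'] V x la that above[OF a(1) that] xa
        triple[OF _ fM[OF a(1)] fM[OF a(2)] fM'[OF a]] by auto
    show "ordered_ultrametric_triple (\<lambda>u v. rint M lt [u, v]) (?d a) (first_diff (b a) (b a')) (?d a')"
      if "?lo a" "\<not> ?lo a'"
      using F.triple[of a x a'] V x la that above[OF a(2) that(2)] xa
        triple[OF _ fM[OF a(1)] fM'[OF a] fM[OF a(2)]] by auto
  qed
  then obtain y where y: "y \<in> seqs" "parity y \<longleftrightarrow> rint F SymN [x]"
    "\<And>a. a \<in> X \<Longrightarrow> b a \<noteq> y \<and> first_diff (b a) y = ?d a \<and> (lex_less (b a) y \<longleftrightarrow> ?lo a)" by blast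
  have "Inl y \<notin> h ` X" using y(3) b(1) by auto
  moreover have "(tri F a x \<longleftrightarrow> tri tree (h a) (Inl y)) \<and> h (fval F a x) = fval tree (h a) (Inl y)"
    if "a \<in> X" for a
    using y(3)[OF that] b(1)[OF that] r(1)[OF fM[OF that]] by (simp add: tree_simps)
  ultimately show ?thesis
    using y(1,2) by (intro exI[of _ "Inl y"]) (simp add: V_tree tree_simps)
qed

lemma is_model_tree:
  assumes "fraisse_limit L0 lt M F" "countable (univ M)"
    "sentence (ext_lang L0) p" "is_model (ext_lang L0) F p"
  shows "is_model (ext_lang L0) tree p"
proof (rule is_model_of_forth[OF assms(1) lt assms(2) K_like_tree _ _ assms(3,4)])
  show "isomorphic L0 (Mstruct tree) M"
    using iso_inv[OF iso_M_tree] by (auto simp: isomorphic_def)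
qed (rule tree_forth[OF fraisse_limit_K_like[OF assms(1)]])

end

section \<open>A coloured dense order containing a given order\<close>

lemma sqrt_2_irrational: "sqrt 2 \<notin> \<rat>"
proof
  assume "sqrt 2 \<in> \<rat>"
  then obtain m n :: nat where n: "n \<noteq> 0" and eq: "\<bar>sqrt 2\<bar> = real m / real n" and co: "coprime m n"
    by (rule Rats_abs_nat_div_natE)
  have "real m = sqrt 2 * real n" using n eq by (simp add: field_simps)
  then have "real (m\<^sup>2) = real (2 * n\<^sup>2)" by (simp add: power_mult_distrib)
  then have mn: "m\<^sup>2 = 2 * n\<^sup>2" by linarith
  then have "even m" by (metis dvd_triv_left even_power pos2)
  then obtain k where "m = 2 * k" by blast
  then have "n\<^sup>2 = 2 * k\<^sup>2" using mn by (simp add: power2_eq_square)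
  then have "even n" by (metis dvd_triv_left even_power pos2)
  with \<open>even m\<close> co show False by auto
qed

text \<open>The rationals are the uncoloured class and their translate by the irrational
  \<open>sqrt 2\<close> the coloured one. All reals would not do, since \<open>L\<close> may be
  smaller than the continuum.\<close>

definition colored_reals :: "real set" where
  "colored_reals = \<rat> \<union> (\<lambda>q. q + sqrt 2) ` \<rat>"

lemma colored_reals_dense:
  assumes "finite P" "finite R" "\<And>p r. p \<in> P \<Longrightarrow> r \<in> R \<Longrightarrow> p < r"
  shows "\<exists>s\<in>colored_reals. (s \<notin> \<rat> \<longleftrightarrow> c) \<and> (\<forall>p\<in>P. p < s) \<and> (\<forall>r\<in>R. s < r)"
proof -
  \<comment> \<open>The cut is replaced by an interval from \<open>u\<close> to \<open>v\<close>;
    the defaults for empty sides only have to keep \<open>u < v\<close>.\<close>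
  define u where "u = (if P = {} then (if R = {} then 0 else Min R - 1) else Max P)"
  define v where "v = (if R = {} then u + 1 else Min R)"
  have "u < v"
  proof (cases "P = {} \<or> R = {}")
    case False
    then show ?thesis using assms(3)[OF Max_in Min_in] assms(1,2) by (simp add: u_def v_def)
  qed (auto simp: u_def v_def)
  have P: "p \<le> u" if "p \<in> P" for p using that assms(1) by (auto simp: u_def)
  have R: "v \<le> r" if "r \<in> R" for r using that assms(2) by (auto simp: v_def)
  have "\<exists>s\<in>colored_reals. (s \<notin> \<rat> \<longleftrightarrow> c) \<and> u < s \<and> s < v"
  proof (cases c)
    case True
    obtain q where q: "q \<in> \<rat>" "u - sqrt 2 < q" "q < v - sqrt 2"
      using Rats_dense_in_real[of "u - sqrt 2" "v - sqrt 2"] \<open>u < v\<close> by auto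
    have "q + sqrt 2 \<notin> \<rat>"
      using Rats_diff[of "q + sqrt 2" q] q(1) sqrt_2_irrational by auto
    then show ?thesis using q True by (intro bexI[of _ "q + sqrt 2"]) (auto simp: colored_reals_def)
  next
    case False
    then show ?thesis using Rats_dense_in_real[OF \<open>u < v\<close>] by (auto simp: colored_reals_def)
  qed
  then show ?thesis using P R by (meson le_less_trans less_le_trans)
qed

lemma countable_colored_reals: "countable colored_reals"
  by (simp add: colored_reals_def countable_rat)

text \<open>Every point of \<open>L\<close> is replaced by a copy of a set of reals, which makes the
  order dense and unbounded even when \<open>L\<close> is neither.\<close>

definition lex_prod_less :: "'l rel \<Rightarrow> 'l \<times> real \<Rightarrow> 'l \<times> real \<Rightarrow> bool" where
  "lex_prod_less r p q \<longleftrightarrow> (fst p, fst q) \<in> r \<or> fst p = fst q \<and> snd p < snd q"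

lemma lex_prod_strict_lin:
  assumes "strict_linear_order_on L r"
  shows "strict_lin_on (L \<times> S) (lex_prod_less r)"
  using assms
  unfolding strict_linear_order_on_def trans_def irrefl_def total_on_def strict_lin_on_def
    lex_prod_less_def
  by (intro conjI ballI impI) (auto, blast+)

lemma lex_prod_dense:
  assumes lin: "strict_linear_order_on L r" and l0: "l0 \<in> L"
    and fin: "finite P" "finite R" and sub: "P \<subseteq> L \<times> colored_reals" "R \<subseteq> L \<times> colored_reals"
    and PR: "\<And>p q. p \<in> P \<Longrightarrow> q \<in> R \<Longrightarrow> lex_prod_less r p q"
  shows "\<exists>q\<in>L \<times> colored_reals. (snd q \<notin> \<rat> \<longleftrightarrow> c) \<and>
    (\<forall>p\<in>P. lex_prod_less r p q) \<and> (\<forall>p\<in>R. lex_prod_less r q p)"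
proof -
  note Q = lex_prod_strict_lin[OF lin, of colored_reals]
  have irr: "(l, l) \<notin> r" for l using lin by (auto simp: strict_linear_order_on_def irrefl_def)
  \<comment> \<open>The new point goes into the fibre of the largest element of \<open>P\<close>, or
    of the least element of \<open>R\<close> if \<open>P\<close> is empty. Points of other fibres
    are then on the correct side, and a cut of reals remains.\<close>
  obtain l where l: "l \<in> L"
    and lP: "\<And>p. p \<in> P \<Longrightarrow> (fst p, l) \<in> r \<or> fst p = l"
    and lR: "\<And>p. p \<in> R \<Longrightarrow> (l, fst p) \<in> r \<or> fst p = l"
  proof -
    consider "P = {}" "R = {}" | "P \<noteq> {}" | "P = {}" "R \<noteq> {}" by blast
    then show thesis
    proof cases
      case 1
      then show thesis using that[OF l0] by blast
    next
      case 2
      then obtain m where m: "m \<in> P" "\<forall>p\<in>P. p \<noteq> m \<longrightarrow> lex_prod_less r p m"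
        using strict_lin_on_finite_min[OF strict_lin_on_converse[OF Q] fin(1)] sub(1) by blast
      show thesis
      proof (rule that[of "fst m"])
        show "fst m \<in> L" using m(1) sub(1) by auto
        show "(fst p, fst m) \<in> r \<or> fst p = fst m" if "p \<in> P" for p
          using that m(2) by (auto simp: lex_prod_less_def)
        show "(fst m, fst p) \<in> r \<or> fst p = fst m" if "p \<in> R" for p
          using PR[OF m(1) that] by (auto simp: lex_prod_less_def)
      qed
    next
      case 3
      then obtain m where m: "m \<in> R" "\<forall>p\<in>R. p \<noteq> m \<longrightarrow> lex_prod_less r m p"
        using strict_lin_on_finite_min[OF Q fin(2)] sub(2) by blast
      show thesis
      proof (rule that[of "fst m"])
        show "fst m \<in> L" using m(1) sub(2) by auto
        show "(fst m, fst p) \<in> r \<or> fst p = fst m" if "p \<in> R" for p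
          using that m(2) by (auto simp: lex_prod_less_def)
      qed (use 3 in simp)
    qed
  qed
  let ?P = "snd ` {p \<in> P. fst p = l}" and ?R = "snd ` {p \<in> R. fst p = l}"
  have "a < b" if "a \<in> ?P" "b \<in> ?R" for a b
    using that PR irr by (fastforce simp: lex_prod_less_def)
  then obtain s where s: "s \<in> colored_reals" "s \<notin> \<rat> \<longleftrightarrow> c" "\<forall>a\<in>?P. a < s" "\<forall>b\<in>?R. s < b"
    using colored_reals_dense[of ?P ?R c] fin by auto
  show ?thesis
  proof (intro bexI[of _ "(l, s)"] conjI ballI)
    show "lex_prod_less r p (l, s)" if "p \<in> P" for p
      using lP[OF that] s(3) that by (auto simp: lex_prod_less_def)
    show "lex_prod_less r (l, s) p" if "p \<in> R" for p
      using lR[OF that] s(4) that by (auto simp: lex_prod_less_def)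
  qed (use l s in auto)
qed

section \<open>Cardinality\<close>

lemma countable_ordLeq_infinite:
  assumes "countable A" "infinite B"
  shows "|A| \<le>o |B|"
proof -
  have "|A| \<le>o |UNIV :: nat set|"
    using assms(1) by (intro card_of_ordLeqI[of "to_nat_on A"]) auto
  then show ?thesis using assms(2) infinite_iff_card_of_nat ordLeq_transitive by blast
qed

text \<open>For each fixed length the bound follows from |A \<times> A| = |A|; there are only
  countably many lengths.\<close>

lemma card_of_lists_ordLeq:
  assumes "infinite A"
  shows "|lists A| \<le>o |A|"
proof -
  let ?n = "\<lambda>n. {xs \<in> lists A. length xs = n}"
  have "|?n n| \<le>o |A|" for n
  proof (induction n)
    case 0
    have "?n 0 = {[]}" by auto
    then show ?case using assms by (simp add: card_of_singl_ordLeq infinite_imp_nonempty)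
  next
    case (Suc n)
    have "?n (Suc n) \<subseteq> (\<lambda>(x, xs). x # xs) ` (A \<times> ?n n)"
      by (force simp: length_Suc_conv)
    then have "|?n (Suc n)| \<le>o |A \<times> ?n n|"
      by (meson card_of_image card_of_mono1 ordLeq_transitive)
    moreover have "|A \<times> ?n n| \<le>o |A \<times> A|" using Suc by (rule card_of_Times_mono2)
    moreover have "|A \<times> A| =o |A|" using assms by (rule card_of_Times_same_infinite)
    ultimately show ?case by (meson ordLeq_ordIso_trans ordLeq_transitive)
  qed
  moreover have "|UNIV :: nat set| \<le>o |A|" using assms infinite_iff_card_of_nat by blast
  ultimately have "|\<Union>n. ?n n| \<le>o |A|"
    using assms by (intro card_of_UNION_ordLeq_infinite) auto
  moreover have "(\<Union>n. ?n n) = lists A" by auto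
  ultimately show ?thesis by simp
qed

lemma card_of_finite_subsets_ordLeq:
  assumes "infinite A"
  shows "|{X. X \<subseteq> A \<and> finite X}| \<le>o |A|"
proof -
  have "{X. X \<subseteq> A \<and> finite X} \<subseteq> set ` lists A"
    using finite_list by (fastforce simp: lists_eq_set)
  then have "|{X. X \<subseteq> A \<and> finite X}| \<le>o |lists A|"
    by (meson card_of_image card_of_mono1 ordLeq_transitive)
  then show ?thesis using card_of_lists_ordLeq[OF assms] ordLeq_transitive by blast
qed

text \<open>A finitely supported function is determined by the part of its graph off the default
  value, a finite subset of \<open>U \<times> Q\<close>.\<close>

lemma (in colored_lin) card_of_seqs_ordLeq:
  assumes "infinite A" "|U| \<le>o |A|" "|Q| \<le>o |A|"
  shows "|seqs| \<le>o |A|"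
proof -
  let ?graph = "\<lambda>s. {(m, s m) |m. s m \<noteq> z}"
  have "inj_on ?graph seqs"
  proof (rule inj_onI)
    fix s t assume eq: "?graph s = ?graph t"
    have "s m = t m" if "s m \<noteq> z \<or> t m \<noteq> z" for m
    proof -
      have "(m, s m) \<in> ?graph t \<or> (m, t m) \<in> ?graph s" using that eq by blast
      then show ?thesis by auto
    qed
    then show "s = t" by (metis ext)
  qed
  moreover have "?graph s \<in> {X. X \<subseteq> U \<times> Q \<and> finite X}" if "s \<in> seqs" for s
  proof -
    have "?graph s = (\<lambda>m. (m, s m)) ` {m. s m \<noteq> z}" by auto
    then have "finite (?graph s)" using seqsD(3)[OF that] by simp
    then show ?thesis using seqsD(1,2)[OF that] by auto
  qed
  ultimately have "|seqs| \<le>o |{X. X \<subseteq> U \<times> Q \<and> finite X}|"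
    by (rule card_of_ordLeqI)
  moreover obtain g where g: "inj_on g (U \<times> Q)" "g ` (U \<times> Q) \<subseteq> A \<times> A"
  proof -
    obtain g1 g2 where g: "inj_on g1 U" "g1 ` U \<subseteq> A" "inj_on g2 Q" "g2 ` Q \<subseteq> A"
      using assms(2,3) unfolding card_of_ordLeq[symmetric] by blast
    show thesis
      by (rule that[of "map_prod g1 g2"]) (use g in \<open>auto simp: map_prod_inj_on\<close>)
  qed
  moreover have "|{X. X \<subseteq> U \<times> Q \<and> finite X}| \<le>o |{X. X \<subseteq> A \<times> A \<and> finite X}|"
  proof (rule card_of_ordLeqI)
    show "inj_on ((`) g) {X. X \<subseteq> U \<times> Q \<and> finite X}"
      using inj_on_image_Pow[OF g(1)] by (rule inj_on_subset) auto
  qed (use g(2) in auto)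
  moreover have "|{X. X \<subseteq> A \<times> A \<and> finite X}| \<le>o |A \<times> A|"
    using assms(1) by (intro card_of_finite_subsets_ordLeq) (auto simp: finite_cartesian_product_iff)
  moreover have "|A \<times> A| =o |A|" using assms(1) by (rule card_of_Times_same_infinite)
  ultimately show ?thesis by (meson ordLeq_ordIso_trans ordLeq_transitive)
qed

section \<open>The model with universe \<open>L\<close> and the embedding\<close>

theorem theorem5p2:
  fixes L0 :: "('f, 'r) lang" and lt :: 'r and M :: "('f, 'r, 'm) struct"
    and \<phi> :: "('f, 'r) fm" and lam :: "'k rel"
    and \<F> :: "('f, 'r, 'a) xstruct" and \<phi>\<^sub>F :: "('f xfun, 'r xrel) fm"
    and L :: "'l set" and lessL :: "'l rel"
  assumes "Card_order lam" and "natLeq <o lam"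
    and "countable_lang L0" and "lt \<in> rels L0" and "rarity L0 lt = 2"
    and "is_struct L0 M" and "countable (univ M)" and "dense_linear_order_struct M lt"
    and "scott_sentence L0 M \<phi>" and "characterizes L0 \<phi> lam"
    and "fraisse_limit L0 lt M \<F>" and "scott_sentence (ext_lang L0) \<F> \<phi>\<^sub>F"
    and "strict_linear_order_on L lessL" and "lam \<le>o |L|"
  shows "\<exists>(G :: ('f, 'r, 'l) xstruct) (F :: 'l \<Rightarrow> 'l).
           is_model (ext_lang L0) G \<phi>\<^sub>F \<and> |univ G| =o |L| \<and>
           F ` L \<subseteq> univ G \<and> inj_on F L \<and>
           (\<forall>x\<in>L. \<forall>y\<in>L. (x, y) \<in> lessL \<longleftrightarrow> tri G (F x) (F y)) \<and>
           (\<forall>x\<in>L. zero_colored G (F x))"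
proof -
  note lt = assms(4,5)
  have "natLeq \<le>o |L|"
    using ordLess_imp_ordLeq[OF assms(2)] assms(14) by (rule ordLeq_transitive)
  then have inf: "infinite L"
    using infinite_iff_card_of_nat card_of_nat ordIso_ordLeq_trans by blast
  then obtain l0 where l0: "l0 \<in> L" by (metis ex_in_conv finite.emptyI)
  have linM: "strict_lin_on (univ M) (\<lambda>u v. rint M lt [u, v])"
  proof -
    have *: "strict_linear_order_on (univ M) {(x, y) \<in> univ M \<times> univ M. rint M lt [x, y]}"
      using assms(8) by (simp add: dense_linear_order_struct_def)
    show ?thesis
      unfolding strict_lin_on_def
    proof (intro conjI ballI impI)
      show "rint M lt [x, z]" if "x \<in> univ M" "y \<in> univ M" "z \<in> univ M"
        "rint M lt [x, y]" "rint M lt [y, z]" for x y z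
        using * that unfolding strict_linear_order_on_def trans_def by blast
    qed (use * in \<open>auto simp: strict_linear_order_on_def irrefl_def total_on_def\<close>)
  qed
  \<comment> \<open>The default value has rational second component, hence is uncoloured;
    \<open>l0\<close> is arbitrary.\<close>
  let ?Q = "L \<times> colored_reals" and ?z = "(l0, 0 :: real)"
  interpret T: tree_struct L0 lt M ?Q "lex_prod_less lessL" "\<lambda>q. snd q \<notin> \<rat>" ?z
  proof
    show "\<exists>q\<in>?Q. (snd q \<notin> \<rat> \<longleftrightarrow> c) \<and> (\<forall>p\<in>P. lex_prod_less lessL p q) \<and> (\<forall>r\<in>R. lex_prod_less lessL q r)"
      if "finite P" "finite R" "P \<subseteq> ?Q" "R \<subseteq> ?Q" "\<And>p r. p \<in> P \<Longrightarrow> r \<in> R \<Longrightarrow> lex_prod_less lessL p r"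
      for P R c
      using lex_prod_dense[OF assms(13) l0 that] .
  qed (use linM assms(6) lt l0 lex_prod_strict_lin[OF assms(13)] in
      \<open>auto simp: is_struct_def colored_reals_def\<close>)

  have sent: "sentence (ext_lang L0) \<phi>\<^sub>F" using assms(12) by (simp add: scott_sentence_def)
  \<comment> \<open>The Scott sentence is specified on structures over \<open>nat\<close>; that the
    limit itself satisfies it is obtained through this copy.\<close>
  obtain B where B: "iso (ext_lang L0) \<F> B (to_nat_on (univ \<F>))"
    using fraisse_limitD(1)[OF assms(11)] inj_on_to_nat_on[OF fraisse_limitD(2)[OF assms(11)]]
    by (rule iso_transport)
  have "is_model (ext_lang L0) B \<phi>\<^sub>F"
    using assms(12) isoD(2)[OF B] iso_inv[OF B]
    unfolding scott_sentence_def isomorphic_def by blast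
  then have "is_model (ext_lang L0) \<F> \<phi>\<^sub>F" using is_model_iso[OF iso_inv[OF B] sent] by blast
  then have tree: "is_model (ext_lang L0) T.tree \<phi>\<^sub>F"
    using T.is_model_tree[OF assms(11,7) sent] by blast

  obtain m0 where m0: "m0 \<in> univ M" using T.U_nonempty by blast
  \<comment> \<open>All these functions can differ only at \<open>m0\<close>, where they are ordered
    as in \<open>L\<close>. The second component 0 keeps every value uncoloured; \<open>l0\<close>
    itself becomes the constant function.\<close>
  define F0 where "F0 l = (\<lambda>_. ?z)(m0 := (l, 0))" for l
  have F0: "F0 l \<in> T.seqs" if "l \<in> L" for l
    unfolding F0_def using that by (intro T.upd_in_seqs T.const_in_seqs m0) (simp add: colored_reals_def)
  have F0_eq: "F0 l = F0 l' \<longleftrightarrow> l = l'" for l l'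
    by (auto simp: F0_def fun_eq_iff)
  have F0_less: "T.lex_less (F0 l) (F0 l') \<longleftrightarrow> (l, l') \<in> lessL" for l l'
  proof (cases "l = l'")
    case True
    then show ?thesis
      using assms(13) by (simp add: T.lex_less_def strict_linear_order_on_def irrefl_def)
  next
    case False
    then have "T.first_diff (F0 l) (F0 l') = m0"
      using m0 strict_lin_onD(1)[OF linM m0] by (intro T.first_diff_eqI) (auto simp: F0_def)
    then show ?thesis
      using False F0_eq by (simp add: T.lex_less_def lex_prod_less_def) (simp add: F0_def)
  qed
  have F0_par: "\<not> T.parity (F0 l)" for l
    by (simp add: T.parity_def F0_def)

  have "|L| \<le>o |univ T.tree|"
    by (rule card_of_ordLeqI[of "\<lambda>l. Inl (F0 l)"]) (auto simp: inj_on_def F0_eq F0 T.univ_tree)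
  moreover have "|univ T.tree| \<le>o |L|"
  proof -
    have "|?Q| \<le>o |L|"
      using countable_ordLeq_infinite[OF countable_colored_reals inf] inf
      by (intro card_of_Times_ordLeq_infinite_Field)
        (auto simp: Field_card_of card_of_card_order_on card_of_mono1)
    then have "|T.seqs| \<le>o |L|"
      by (rule T.card_of_seqs_ordLeq[OF inf countable_ordLeq_infinite[OF assms(7) inf]])
    then have "|Inl ` T.seqs| \<le>o |L|" by (rule ordLeq_transitive[OF card_of_image])
    moreover have "|Inr ` univ M| \<le>o |L|"
      using countable_ordLeq_infinite[OF assms(7) inf] by (rule ordLeq_transitive[OF card_of_image])
    ultimately show ?thesis
      unfolding T.univ_tree using inf by (intro card_of_Un_ordLeq_infinite_Field)
        (auto simp: Field_card_of card_of_card_order_on)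
  qed
  \<comment> \<open>Equality of cardinals allows the tree to be relabelled by the elements of
    \<open>L\<close>; this relabelling is unrelated to the embedding \<open>F\<close>.\<close>
  ultimately obtain f where f: "bij_betw f (univ T.tree) L"
    using card_of_ordIso ordIso_iff_ordLeq by blast
  obtain G :: "('f, 'r, 'l) xstruct" where G: "iso (ext_lang L0) T.tree G f" "univ G = f ` univ T.tree"
    using T.K_like_tree[THEN K_like.is_struct_ext] bij_betw_imp_inj_on[OF f] by (rule iso_transport)
  have uG: "univ G = L" using G(2) f by (simp add: bij_betw_def)
  define F where "F l = f (Inl (F0 l))" for l
  note e = iso_extD[OF G(1)]
  have mem: "Inl (F0 l) \<in> univ T.tree" if "l \<in> L" for l using F0[OF that] by (simp add: T.univ_tree)
  show ?thesis
  proof (intro exI[of _ G] exI[of _ F] conjI ballI)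
    show "is_model (ext_lang L0) G \<phi>\<^sub>F" using is_model_iso[OF G(1) sent tree] .
    show "|univ G| =o |L|" unfolding uG by (rule card_of_refl)
    show "F ` L \<subseteq> univ G" using mem by (auto simp: G(2) F_def)
    show "inj_on F L"
      using inj_onD[OF bij_betw_imp_inj_on[OF f] _ mem mem] F0_eq
      by (fastforce simp: F_def intro: inj_onI)
    show "(x, y) \<in> lessL \<longleftrightarrow> tri G (F x) (F y)" if "x \<in> L" "y \<in> L" for x y
      using e(4)[OF mem mem] that F0_less by (simp add: F_def T.tree_simps)
    show "zero_colored G (F x)" if "x \<in> L" for x
      using e(1,3)[OF mem[OF that]] F0[OF that] F0_par
      by (simp add: zero_colored_def F_def T.V_tree T.tree_simps)
  qed
qed

end
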